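(* Let $(\mathbf{V},\mathbf{E})$ be a finite connected graph with at least two vertices and with edge-weights $\mathbf{w} = (w_e)$, $w_e > 0$ for all $e \in \mathbf{E}$, and let $(Z_t)_{t \ge 0}$ be the associated multigraph-valued process in which copies of each edge $e \in \mathbf{E}$ appear at the times of independent rate-$w_e$ Poisson processes. Define \[ T^{span}_k = \inf\{t : Z_t \text{ contains } k \text{ edge-disjoint spanning trees}\}, \qquad T^{tria}_k = \inf\{t : Z_t \text{ contains } k \text{ edge-disjoint triangles}\}. \] Then \[ \frac{\mathrm{s.d.}(T^{span}_k)}{\mathbb{E} T^{span}_k} \le \frac{1}{\sqrt{k}}, \qquad k \ge 1, \] and, if $(\mathbf{V},\mathbf{E})$ contains a triangle, \[ \frac{\mathrm{s.d.}(T^{tria}_k)}{\mathbb{E} T^{tria}_k} \le \left(\frac{e}{e-1}\right)^{1/2} k^{-1/6}, \qquad k \ge 1, \] where in the last bound $e$ is the base of natural logarithms.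
   Context: The process $(Z_t)$: initially there is the vertex-set $\mathbf{V}$ and no edges. For each vertex-pair $e = (vy) \in \mathbf{E}$, edges (copies) $vy$ appear at the times of a Poisson process of rate $w_e$, independently over $e \in \mathbf{E}$. So $Z_t$ is a multigraph with $N_e(t) \ge 0$ copies of edge $e$, where $(N_e(t), e \in \mathbf{E})$ are independent Poisson($t w_e$) random variables. The $N_e(t)$ copies of $e$ are regarded as disjoint (distinct) edges, so edge-disjoint trees or triangles may use different copies of the same edge $e$. $\mathrm{s.d.}$ denotes standard deviation. *)

theory Defs
  imports "HOL-Probability.Probability"
begin

section \<open>Graphs and multigraphs\<close>

definition simple_graph :: "'v set \<Rightarrow> 'v set set \<Rightarrow> bool" where
  "simple_graph V E \<longleftrightarrow> (\<forall>e\<in>E. e \<subseteq> V \<and> card e = 2)"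

definition connected_graph :: "'v set \<Rightarrow> 'v set set \<Rightarrow> bool" where
  "connected_graph V E \<longleftrightarrow> (\<forall>u\<in>V. \<forall>v\<in>V. (u, v) \<in> {(x, y). {x, y} \<in> E}\<^sup>*)"

definition contains_triangle :: "'v set set \<Rightarrow> bool" where
  "contains_triangle E \<longleftrightarrow>
     (\<exists>x y z. x \<noteq> y \<and> y \<noteq> z \<and> x \<noteq> z \<and> {x, y} \<in> E \<and> {y, z} \<in> E \<and> {x, z} \<in> E)"

text \<open>
  An edge of a multigraph is a pair \<open>(e, i)\<close>, the \<open>i\<close>-th copy of the vertex pair \<open>e\<close>
  (counting from 0). Distinct copies of the same vertex pair are distinct edges.
\<close>

type_synonym 'v edge_copy = "'v set \<times> nat"

definition edge_copies :: "'v set set \<Rightarrow> ('v set \<Rightarrow> nat) \<Rightarrow> 'v edge_copy set" where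
  "edge_copies E n = (SIGMA e:E. {..<n e})"

text \<open>
  A cycle visits the distinct vertices \<open>vs\<close> through the distinct edges \<open>cs\<close>. Length 2 is
  allowed, so two parallel copies of the same vertex pair form a cycle.
\<close>

definition multigraph_cycle :: "'v list \<Rightarrow> 'v edge_copy list \<Rightarrow> bool" where
  "multigraph_cycle vs cs \<longleftrightarrow>
     2 \<le> length vs \<and> length cs = length vs \<and> distinct vs \<and> distinct cs \<and>
     (\<forall>i<length vs. fst (cs ! i) = {vs ! i, vs ! (Suc i mod length vs)})"

definition spanning_tree :: "'v set \<Rightarrow> 'v edge_copy set \<Rightarrow> bool" where
  "spanning_tree V S \<longleftrightarrow>
     connected_graph V (fst ` S) \<and> (\<nexists>vs cs. multigraph_cycle vs cs \<and> set cs \<subseteq> S)"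

definition triangle :: "'v edge_copy set \<Rightarrow> bool" where
  "triangle S \<longleftrightarrow>
     (\<exists>x y z i j l. x \<noteq> y \<and> y \<noteq> z \<and> x \<noteq> z \<and> S = {({x, y}, i), ({y, z}, j), ({x, z}, l)})"

definition contains_edge_disjoint ::
  "('v edge_copy set \<Rightarrow> bool) \<Rightarrow> nat \<Rightarrow> 'v edge_copy set \<Rightarrow> bool" where
  "contains_edge_disjoint P k C \<longleftrightarrow>
     (\<exists>S. (\<forall>i<k. S i \<subseteq> C \<and> P (S i)) \<and> disjoint_family_on S {..<k})"


section \<open>Poisson processes\<close>

text \<open>
  \<open>N t\<close> is the number of points in \<open>{0<..t}\<close>; only times \<open>t \<ge> 0\<close> matter. Since
  paths are nondecreasing, the subtractions on \<^typ>\<open>nat\<close> do not truncate.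
\<close>

definition poisson_process :: "'a measure \<Rightarrow> real \<Rightarrow> (real \<Rightarrow> 'a \<Rightarrow> nat) \<Rightarrow> bool" where
  "poisson_process M r N \<longleftrightarrow>
     (\<forall>t\<ge>0. N t \<in> measurable M (count_space UNIV)) \<and>
     (\<forall>\<omega>\<in>space M. N 0 \<omega> = 0 \<and> mono_on {0..} (\<lambda>t. N t \<omega>) \<and>
        (\<forall>t\<ge>0. continuous (at_right t) (\<lambda>s. N s \<omega>))) \<and>
     (\<forall>s t. 0 \<le> s \<longrightarrow> s < t \<longrightarrow>
        distr M (count_space UNIV) (\<lambda>\<omega>. N t \<omega> - N s \<omega>) = measure_pmf (poisson_pmf (r * (t - s)))) \<and>
     (\<forall>n (\<tau>::nat \<Rightarrow> real). 0 \<le> \<tau> 0 \<longrightarrow> mono \<tau> \<longrightarrow>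
        prob_space.indep_vars M (\<lambda>_. count_space UNIV)
          (\<lambda>i \<omega>. N (\<tau> (Suc i)) \<omega> - N (\<tau> i) \<omega>) {..<n})"

text \<open>
  Independence of whole processes: each \<open>N e\<close> is viewed as one random element of the space of
  functions on \<open>{0..}\<close> with the product sigma-algebra.
\<close>

definition indep_poisson_processes ::
  "'a measure \<Rightarrow> 'e set \<Rightarrow> ('e \<Rightarrow> real) \<Rightarrow> ('e \<Rightarrow> real \<Rightarrow> 'a \<Rightarrow> nat) \<Rightarrow> bool" where
  "indep_poisson_processes M E w N \<longleftrightarrow>
     (\<forall>e\<in>E. poisson_process M (w e) (N e)) \<and>
     prob_space.indep_vars M (\<lambda>_. PiM {0..} (\<lambda>_. count_space UNIV))
       (\<lambda>e \<omega>. \<lambda>t\<in>{0..}. N e t \<omega>) E"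


section \<open>The multigraph process and its hitting times\<close>

definition multigraph_process ::
  "'v set set \<Rightarrow> ('v set \<Rightarrow> real \<Rightarrow> 'a \<Rightarrow> nat) \<Rightarrow> real \<Rightarrow> 'a \<Rightarrow> 'v edge_copy set" where
  "multigraph_process E N t \<omega> = edge_copies E (\<lambda>e. N e t \<omega>)"

text \<open>The infimum of the empty set of times is \<open>\<infinity>\<close>.\<close>

definition T_span ::
  "'v set \<Rightarrow> 'v set set \<Rightarrow> ('v set \<Rightarrow> real \<Rightarrow> 'a \<Rightarrow> nat) \<Rightarrow> nat \<Rightarrow> 'a \<Rightarrow> ennreal" where
  "T_span V E N k \<omega> =
     (INF t\<in>{t. 0 \<le> t \<and> contains_edge_disjoint (spanning_tree V) k (multigraph_process E N t \<omega>)}.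
        ennreal t)"

definition T_tria ::
  "'v set set \<Rightarrow> ('v set \<Rightarrow> real \<Rightarrow> 'a \<Rightarrow> nat) \<Rightarrow> nat \<Rightarrow> 'a \<Rightarrow> ennreal" where
  "T_tria E N k \<omega> =
     (INF t\<in>{t. 0 \<le> t \<and> contains_edge_disjoint triangle k (multigraph_process E N t \<omega>)}.
        ennreal t)"


section \<open>Moments\<close>

text \<open>
  On a probability space this implies that \<open>T\<close> is finite almost surely and that
  \<open>\<lambda>\<omega>. enn2real (T \<omega>)\<close> and its square are integrable, so that \<open>mean\<close> and \<open>sd\<close> below
  are the mean and standard deviation of \<open>T\<close>.
\<close>

definition finite_second_moment :: "'a measure \<Rightarrow> ('a \<Rightarrow> ennreal) \<Rightarrow> bool" where
  "finite_second_moment M T \<longleftrightarrow>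
     T \<in> borel_measurable M \<and> (\<integral>\<^sup>+\<omega>. (T \<omega>)\<^sup>2 \<partial>M) < \<infinity>"

definition mean :: "'a measure \<Rightarrow> ('a \<Rightarrow> ennreal) \<Rightarrow> real" where
  "mean M T = prob_space.expectation M (\<lambda>\<omega>. enn2real (T \<omega>))"

definition sd :: "'a measure \<Rightarrow> ('a \<Rightarrow> ennreal) \<Rightarrow> real" where
  "sd M T = sqrt (prob_space.variance M (\<lambda>\<omega>. enn2real (T \<omega>)))"

end

theory Submission
  imports Defs
begin

text \<open>
  The jump chain of the edge counts is a random walk. If \<open>K\<close> is its hitting time of an up-closed
  set of counts and \<open>h\<close> is the expectation of \<open>K\<close> as a function of the starting point, then the
  one-step decrements of \<open>h\<close> average to 1. Hence, if they all lie between 0 and \<open>c\<close>, the variance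
  of the continuous-time hitting time \<open>T\<close> is at most \<open>c / h\<close> times the square of its mean. By
  coupling, the decrement is at most the expected remaining time when only one edge is missing.

  For spanning trees, one missing edge can be replaced by any edge across some cut, so that
  \<open>c = 1 / q\<close>, where \<open>q\<close> is the probability that a step crosses this cut; on the other hand every
  cut has to be crossed \<open>k\<close> times, so \<open>h \<ge> k / q\<close>.

  For triangles, one missing edge spoils at most one triangle, so \<open>c\<close> is the expected time to the
  first triangle. Thinning compares it with \<open>h\<close>: if each copy is kept with probability
  \<open>k powr (- 1 / 3)\<close>, then each of \<open>k\<close> disjoint triangles survives with probability \<open>1 / k\<close>.
\<close>

section \<open>Hitting times of a random walk on edge counts\<close>

definition bump :: "'e \<Rightarrow> ('e \<Rightarrow> nat) \<Rightarrow> 'e \<Rightarrow> nat" where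
  "bump e n = n(e := Suc (n e))"

lemma bump_commute: "bump e (bump e' n) = bump e' (bump e n)"
  by (auto simp: bump_def)

locale random_walk =
  fixes E :: "'e set" and p :: "'e \<Rightarrow> real"
  assumes finite_E: "finite E"
    and p_pos: "e \<in> E \<Longrightarrow> 0 < p e"
    and sum_p: "sum p E = 1"
begin

text \<open>
  The walk adds one copy of an edge \<open>e\<close> with probability \<open>p e\<close> at each step. For an up-closed
  set \<open>U\<close> of counts, let \<open>K\<close> be the number of steps until \<open>U\<close> is entered from \<open>n\<close>.
  Then \<open>avoid U m n\<close> is the probability of \<open>K > m\<close>, \<open>hit U M n\<close> is the expectation of
  \<open>min K M\<close>, and \<open>hit2 U M n\<close> is that of \<open>min K M * (min K M + 1)\<close>.
\<close>

primrec avoid :: "(('e \<Rightarrow> nat) \<Rightarrow> bool) \<Rightarrow> nat \<Rightarrow> ('e \<Rightarrow> nat) \<Rightarrow> real" where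
  "avoid U 0 n = (if U n then 0 else 1)"
| "avoid U (Suc m) n = (\<Sum>e\<in>E. p e * avoid U m (bump e n))"

definition hit :: "(('e \<Rightarrow> nat) \<Rightarrow> bool) \<Rightarrow> nat \<Rightarrow> ('e \<Rightarrow> nat) \<Rightarrow> real" where
  "hit U M n = (\<Sum>m<M. avoid U m n)"

definition hit2 :: "(('e \<Rightarrow> nat) \<Rightarrow> bool) \<Rightarrow> nat \<Rightarrow> ('e \<Rightarrow> nat) \<Rightarrow> real" where
  "hit2 U M n = (\<Sum>m<M. 2 * (real m + 1) * avoid U m n)"

lemma p_nonneg: "e \<in> E \<Longrightarrow> 0 \<le> p e"
  using p_pos by force

lemma average_mono: "(\<And>e. e \<in> E \<Longrightarrow> f e \<le> g e) \<Longrightarrow> (\<Sum>e\<in>E. p e * f e) \<le> (\<Sum>e\<in>E. p e * g e)"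
  by (intro sum_mono mult_left_mono p_nonneg)

lemma average_const: "(\<Sum>e\<in>E. p e * c) = c"
  by (simp add: sum_distrib_right[symmetric] sum_p)

lemma average_le: "(\<And>e. e \<in> E \<Longrightarrow> f e \<le> c) \<Longrightarrow> (\<Sum>e\<in>E. p e * f e) \<le> c"
  using average_mono[of f "\<lambda>_. c"] by (simp add: average_const)

lemma avoid_nonneg: "0 \<le> avoid U m n"
  by (induction m arbitrary: n) (auto intro!: sum_nonneg mult_nonneg_nonneg p_nonneg)

lemma avoid_le_1: "avoid U m n \<le> 1"
  by (induction m arbitrary: n) (auto intro!: average_le)

text \<open>Coupling: both walks make the same steps, so their difference \<open>n0\<close>
  persists, and whenever the walk from \<open>n\<close> is in \<open>V\<close> the other one is in
  \<open>U\<close>.\<close>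

lemma avoid_compare:
  assumes "\<And>n. V n \<Longrightarrow> U (\<lambda>e. n0 e + n e)"
  shows "avoid U m (\<lambda>e. n0 e + n e) \<le> avoid V m n"
proof (induction m arbitrary: n)
  case 0
  then show ?case using assms by auto
next
  case (Suc m)
  have "bump e (\<lambda>e. n0 e + n e) = (\<lambda>x. n0 x + bump e n x)" for e
    by (auto simp: bump_def)
  then show ?case using Suc by (auto intro!: average_mono)
qed

lemma hit_nonneg: "0 \<le> hit U M n"
  unfolding hit_def by (intro sum_nonneg avoid_nonneg)

lemma hit_mono: "M \<le> M' \<Longrightarrow> hit U M n \<le> hit U M' n"
  unfolding hit_def by (intro sum_mono2) (auto simp: avoid_nonneg)

lemma hit_Suc: "hit U (Suc M) n = avoid U 0 n + (\<Sum>e\<in>E. p e * hit U M (bump e n))"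
  unfolding hit_def sum.lessThan_Suc_shift
  by (simp add: sum_distrib_left sum.swap[of _ _ E])

text \<open>After the first step K = 1 + K', and K (K + 1) = 2 K + K' (K' + 1), so no mixed term
  appears. Up to the squared rate, K (K + 1) is also the second moment of a sum of K independent
  exponential waiting times.\<close>

lemma hit2_Suc:
  "hit2 U (Suc M) n = 2 * hit U (Suc M) n + (\<Sum>e\<in>E. p e * hit2 U M (bump e n))"
proof -
  have "(\<Sum>e\<in>E. p e * hit2 U M (bump e n)) = (\<Sum>m<M. 2 * (real m + 1) * avoid U (Suc m) n)"
    unfolding hit2_def by (simp add: sum_distrib_left sum.swap[of _ _ E] mult_ac)
  moreover have "hit2 U (Suc M) n - 2 * hit U (Suc M) n
      = (\<Sum>m<Suc M. 2 * real m * avoid U m n)"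
    unfolding hit2_def hit_def sum_distrib_left sum_subtractf[symmetric]
    by (intro sum.cong refl) (simp add: algebra_simps)
  moreover have "\<dots> = (\<Sum>m<M. 2 * (real m + 1) * avoid U (Suc m) n)"
    unfolding sum.lessThan_Suc_shift by (simp add: add_ac)
  ultimately show ?thesis by linarith
qed

text \<open>Optional stopping: before \<open>U\<close> is entered, \<open>B\<close> plus the elapsed
  time is a submartingale. At the stopping time \<open>B\<close> is at most \<open>b\<close> on
  \<open>U\<close>, and the excess \<open>D\<close> is charged only if \<open>U\<close> has not been
  reached after \<open>M\<close> steps.\<close>

lemma subsolution_le:
  assumes step: "\<And>n. \<not> U n \<Longrightarrow> B n \<le> 1 + (\<Sum>e\<in>E. p e * B (bump e n))"
    and on: "\<And>n. U n \<Longrightarrow> B n \<le> b" and le: "\<And>n. B n \<le> b + D" and "0 \<le> D"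
  shows "B n \<le> hit U M n + b + D * avoid U M n"
proof (induction M arbitrary: n)
  case 0
  then show ?case using on le by (auto simp: hit_def)
next
  case (Suc M)
  show ?case
  proof (cases "U n")
    case True
    then have "B n \<le> b" by (rule on)
    also have "\<dots> \<le> hit U (Suc M) n + b + D * avoid U (Suc M) n"
      using hit_nonneg avoid_nonneg \<open>0 \<le> D\<close> by (metis add.commute add_increasing2 le_add_same_cancel1 add_nonneg_nonneg mult_nonneg_nonneg)
    finally show ?thesis .
  next
    case False
    have "B n \<le> 1 + (\<Sum>e\<in>E. p e * B (bump e n))" by (rule step[OF False])
    also have "\<dots> \<le> 1 + (\<Sum>e\<in>E. p e * (hit U M (bump e n) + b + D * avoid U M (bump e n)))"
      by (intro add_left_mono average_mono Suc)
    also have "\<dots> = 1 + ((\<Sum>e\<in>E. p e * hit U M (bump e n)) + b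
        + D * (\<Sum>e\<in>E. p e * avoid U M (bump e n)))"
      using average_const[of b] by (simp add: distrib_left sum.distrib sum_distrib_left mult_ac)
    also have "\<dots> = hit U (Suc M) n + b + D * avoid U (Suc M) n"
      using False by (simp add: hit_Suc)
    finally show ?thesis .
  qed
qed

end

section \<open>Monotonicity and second moments for up-closed targets\<close>

locale hitting = random_walk +
  fixes U :: "('a \<Rightarrow> nat) \<Rightarrow> bool"
  assumes up: "U n \<Longrightarrow> (\<And>e. n e \<le> n' e) \<Longrightarrow> U n'"
begin

lemma up_bump: "U n \<Longrightarrow> U (bump e n)"
  by (rule up) (auto simp: bump_def)

lemma avoid_on: "U n \<Longrightarrow> avoid U m n = 0"
  by (induction m arbitrary: n) (auto simp: up_bump)

lemma hit_on: "U n \<Longrightarrow> hit U M n = 0"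
  by (simp add: hit_def avoid_on)

lemma avoid_bump: "e \<in> E \<Longrightarrow> avoid U m (bump e n) \<le> avoid U m n"
proof (induction m arbitrary: n)
  case 0
  then show ?case using up_bump by auto
next
  case (Suc m)
  then show ?case by (auto simp: bump_commute[of _ e] intro!: average_mono)
qed

lemma hit_bump: "e \<in> E \<Longrightarrow> hit U M (bump e n) \<le> hit U M n"
  unfolding hit_def by (intro sum_mono avoid_bump)

text \<open>Since \<open>B\<close> is nonnegative, stopping after \<open>M\<close> steps can only
  help, and no error term arises as it does for lower bounds.\<close>

lemma hit_le_supersolution:
  assumes step: "\<And>n. \<not> U n \<Longrightarrow> 1 + (\<Sum>e\<in>E. p e * B (bump e n)) \<le> B n"
    and "\<And>n. 0 \<le> B n"
  shows "hit U M n \<le> B n"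
proof (induction M arbitrary: n)
  case 0
  then show ?case using assms by (auto simp: hit_def)
next
  case (Suc M)
  show ?case
  proof (cases "U n")
    case True
    then show ?thesis using assms by (simp add: hit_on)
  next
    case False
    have "hit U (Suc M) n = 1 + (\<Sum>e\<in>E. p e * hit U M (bump e n))"
      using False by (simp add: hit_Suc)
    also have "\<dots> \<le> 1 + (\<Sum>e\<in>E. p e * B (bump e n))"
      by (intro add_left_mono average_mono Suc)
    also have "\<dots> \<le> B n" by (rule step[OF False])
    finally show ?thesis .
  qed
qed

text \<open>Couple the walks from \<open>n\<close> and \<open>bump e n\<close>. While the second is
  outside \<open>U\<close>, so is the first, and both clocks advance together; once the second has
  entered, the first lacks at most the extra copy of \<open>e\<close>, and \<open>jump\<close>
  bounds the remaining time. The horizons differ by one because the walk at \<open>bump e n\<close>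
  has already used a step; \<open>1 \<le> c\<close> pays for that step when
  \<open>M = 0\<close>.\<close>

lemma hit_diff_le:
  assumes jump: "\<And>n M. U (bump e n) \<Longrightarrow> hit U M n \<le> c" and "1 \<le> c" and "e \<in> E"
  shows "hit U (Suc M) n - hit U M (bump e n) \<le> c"
proof (induction M arbitrary: n)
  case 0
  then show ?case using \<open>1 \<le> c\<close> by (auto simp: hit_def)
next
  case (Suc M)
  show ?case
  proof (cases "U (bump e n)")
    case True
    then show ?thesis using jump by (simp add: hit_on)
  next
    case False
    then have "\<not> U n" using up_bump by blast
    have "hit U (Suc (Suc M)) n - hit U (Suc M) (bump e n) =
        (\<Sum>e'\<in>E. p e' * (hit U (Suc M) (bump e' n) - hit U M (bump e (bump e' n))))"
      unfolding hit_Suc[of U "Suc M" n] hit_Suc[of U M "bump e n"]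
      using False \<open>\<not> U n\<close> by (simp add: bump_commute[of _ e] right_diff_distrib sum_subtractf)
    also have "\<dots> \<le> c" by (intro average_le Suc)
    finally show ?thesis .
  qed
qed

text \<open>The decrements \<open>d e\<close> have average 1 and lie between 0 and \<open>c\<close>,
  so their second moment is at most \<open>c\<close>. Hence the average of
  \<open>(H - d e)\<^sup>2\<close> is at most \<open>H\<^sup>2 - 2 * H + c\<close>, and adding the
  terms \<open>2 * H\<close> and \<open>c * (H - 1)\<close> of the recursion gives the
  bound.\<close>

lemma hit2_le:
  assumes jump: "\<And>n e M. e \<in> E \<Longrightarrow> U (bump e n) \<Longrightarrow> hit U M n \<le> c" and "1 \<le> c"
  shows "hit2 U M n \<le> (hit U M n)\<^sup>2 + c * hit U M n"
proof (induction M arbitrary: n)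
  case 0
  then show ?case by (simp add: hit_def hit2_def)
next
  case (Suc M)
  show ?case
  proof (cases "U n")
    case True
    then show ?thesis by (simp add: hit_on hit2_def avoid_on)
  next
    case False
    define H where "H = hit U (Suc M) n"
    define d where "d e = H - hit U M (bump e n)" for e
    have H: "H = 1 + (\<Sum>e\<in>E. p e * hit U M (bump e n))"
      unfolding H_def using False by (simp add: hit_Suc)
    have d_ge: "0 \<le> d e" if "e \<in> E" for e
      unfolding d_def H_def using hit_bump[OF that, of M n] hit_mono[of M "Suc M" U n] by simp
    have d_le: "d e \<le> c" if "e \<in> E" for e
      unfolding d_def H_def using jump[OF that] \<open>1 \<le> c\<close> that by (intro hit_diff_le)
    have d_sum: "(\<Sum>e\<in>E. p e * d e) = 1"
      unfolding d_def by (simp add: right_diff_distrib sum_subtractf average_const H)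
    have "hit2 U (Suc M) n = 2 * H + (\<Sum>e\<in>E. p e * hit2 U M (bump e n))"
      unfolding H_def by (rule hit2_Suc)
    also have "\<dots> \<le> 2 * H + (\<Sum>e\<in>E. p e * ((hit U M (bump e n))\<^sup>2 + c * hit U M (bump e n)))"
      by (intro add_left_mono average_mono Suc)
    also have "\<dots> = 2 * H + (\<Sum>e\<in>E. p e * (H - d e)\<^sup>2) + c * (H - 1)"
      by (simp add: H d_def distrib_left sum.distrib sum_distrib_left mult_ac)
    also have "(\<Sum>e\<in>E. p e * (H - d e)\<^sup>2)
        = H\<^sup>2 - 2 * H * (\<Sum>e\<in>E. p e * d e) + (\<Sum>e\<in>E. p e * (d e)\<^sup>2)"
      using average_const[of "H\<^sup>2"]
      by (simp add: power2_diff algebra_simps sum.distrib sum_subtractf sum_distrib_left)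
    also have "(\<Sum>e\<in>E. p e * (d e)\<^sup>2) \<le> (\<Sum>e\<in>E. p e * (c * d e))"
      using d_ge d_le by (intro average_mono) (simp add: power2_eq_square mult_right_mono)
    also have "\<dots> = c"
      using d_sum by (simp add: sum_distrib_left[symmetric] mult.left_commute)
    finally show ?thesis
      using d_sum by (simp add: H_def[symmetric] algebra_simps)
  qed
qed

end

section \<open>Infinite horizon: expected hitting times\<close>

context hitting
begin

text \<open>By the tail-sum formula this is the expectation of K once the series converges, which
  \<open>summable_avoid\<close> shows.\<close>

definition mean_hit :: "('a \<Rightarrow> nat) \<Rightarrow> real" where
  "mean_hit n = (\<Sum>m. avoid U m n)"

end

locale recurrent_hitting = hitting +
  fixes k :: nat
  assumes reach: "(\<And>e. e \<in> E \<Longrightarrow> k \<le> n e) \<Longrightarrow> U n"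
begin

text \<open>Each missing copy of \<open>e\<close> is charged its mean waiting time
  \<open>1 / p e\<close>. A step lowers the total by 1 on average for every edge with fewer than
  \<open>k\<close> copies, and outside \<open>U\<close> there is such an edge.\<close>

lemma hit_bounded: "hit U M n \<le> (\<Sum>e\<in>E. real (k - n e) / p e)"
proof (rule hit_le_supersolution)
  fix n :: "'a \<Rightarrow> nat"
  show "0 \<le> (\<Sum>e\<in>E. real (k - n e) / p e)"
    by (auto intro!: sum_nonneg divide_nonneg_nonneg p_nonneg)
  assume "\<not> U n"
  then obtain e0 where e0: "e0 \<in> E" "n e0 < k"
    using reach by (metis not_le)
  let ?B = "\<lambda>n. \<Sum>e\<in>E. real (k - n e) / p e"
  have drop: "?B (bump e n) = ?B n - (if n e < k then 1 / p e else 0)" if "e \<in> E" for e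
    using finite_E that by (simp add: sum.remove bump_def of_nat_diff diff_divide_distrib add_divide_distrib)
  have "(\<Sum>e\<in>E. p e * ?B (bump e n)) = (\<Sum>e\<in>E. p e * ?B n - (if n e < k then 1 else 0))"
    using p_pos by (intro sum.cong refl) (force simp: drop right_diff_distrib)
  also have "\<dots> = ?B n - (\<Sum>e\<in>E. if n e < k then 1 else 0)"
    by (simp add: sum_subtractf average_const)
  finally have "(\<Sum>e\<in>E. p e * ?B (bump e n)) = ?B n - (\<Sum>e\<in>E. if n e < k then 1 else 0)" .
  moreover have "(\<Sum>e\<in>{e0}. if n e < k then 1 else 0 :: real) \<le> (\<Sum>e\<in>E. if n e < k then 1 else 0)"
    using finite_E e0 by (intro sum_mono2) auto
  ultimately show "1 + (\<Sum>e\<in>E. p e * ?B (bump e n)) \<le> ?B n"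
    using e0 by simp
qed

lemma summable_avoid: "summable (\<lambda>m. avoid U m n)"
proof (rule summableI_nonneg_bounded)
  show "(\<Sum>m<M. avoid U m n) \<le> (\<Sum>e\<in>E. real (k - n e) / p e)" for M
    using hit_bounded[of M n] by (simp add: hit_def)
qed (rule avoid_nonneg)

lemma hit_tendsto: "(\<lambda>M. hit U M n) \<longlonglongrightarrow> mean_hit n"
  using summable_LIMSEQ[OF summable_avoid] by (simp add: hit_def mean_hit_def)

lemma hit_le_mean_hit: "hit U M n \<le> mean_hit n"
  unfolding hit_def mean_hit_def using summable_avoid avoid_nonneg by (intro sum_le_suminf) auto

lemma mean_hit_nonneg: "0 \<le> mean_hit n"
  using hit_le_mean_hit[of 0 n] by (simp add: hit_def)

lemma mean_hit_on: "U n \<Longrightarrow> mean_hit n = 0"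
  by (simp add: mean_hit_def avoid_on)

lemma mean_hit_rec:
  "mean_hit n = avoid U 0 n + (\<Sum>e\<in>E. p e * mean_hit (bump e n))"
proof (rule LIMSEQ_unique)
  show "(\<lambda>M. hit U (Suc M) n) \<longlonglongrightarrow> mean_hit n"
    using hit_tendsto by (rule LIMSEQ_Suc)
  show "(\<lambda>M. hit U (Suc M) n) \<longlonglongrightarrow> avoid U 0 n + (\<Sum>e\<in>E. p e * mean_hit (bump e n))"
    unfolding hit_Suc by (intro tendsto_intros hit_tendsto)
qed

lemma mean_hit_ge_1: "\<not> U n \<Longrightarrow> 1 \<le> mean_hit n"
  using hit_le_mean_hit[of 1 n] by (simp add: hit_def)

text \<open>Summability makes the error \<open>D * avoid U M n\<close> vanish in the limit, so
  \<open>D\<close> does not enter the bound; it is enough that \<open>B\<close> is bounded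
  above.\<close>

lemma subsolution_le_mean_hit:
  assumes "\<And>n. \<not> U n \<Longrightarrow> B n \<le> 1 + (\<Sum>e\<in>E. p e * B (bump e n))"
    and "\<And>n. U n \<Longrightarrow> B n \<le> b" and "\<And>n. B n \<le> b + D" and "0 \<le> D"
  shows "B n \<le> mean_hit n + b"
proof (rule LIMSEQ_le_const)
  have "(\<lambda>M. hit U M n + b + D * avoid U M n) \<longlonglongrightarrow> mean_hit n + b + D * 0"
    by (intro tendsto_intros hit_tendsto summable_LIMSEQ_zero summable_avoid)
  then show "(\<lambda>M. hit U M n + b + D * avoid U M n) \<longlonglongrightarrow> mean_hit n + b"
    by simp
  show "\<exists>M0. \<forall>M\<ge>M0. B n \<le> hit U M n + b + D * avoid U M n"
    using subsolution_le[of U B b D] assms by blast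
qed

lemma second_moment_le:
  assumes jump: "\<And>n e M. e \<in> E \<Longrightarrow> U (bump e n) \<Longrightarrow> hit U M n \<le> c" and "1 \<le> c"
  shows "summable (\<lambda>m. 2 * (real m + 1) * avoid U m n)"
    and "(\<Sum>m. 2 * (real m + 1) * avoid U m n) \<le> (mean_hit n)\<^sup>2 + c * mean_hit n"
proof -
  have bound: "(\<Sum>m<M. 2 * (real m + 1) * avoid U m n) \<le> (mean_hit n)\<^sup>2 + c * mean_hit n" for M
  proof -
    have "hit2 U M n \<le> (hit U M n)\<^sup>2 + c * hit U M n"
      using assms by (rule hit2_le)
    also have "\<dots> \<le> (mean_hit n)\<^sup>2 + c * mean_hit n"
      using hit_le_mean_hit hit_nonneg \<open>1 \<le> c\<close>
      by (intro add_mono power_mono mult_left_mono) auto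
    finally show ?thesis by (simp add: hit2_def)
  qed
  show sm: "summable (\<lambda>m. 2 * (real m + 1) * avoid U m n)"
    using bound by (intro summableI_nonneg_bounded) (auto intro!: mult_nonneg_nonneg avoid_nonneg)
  show "(\<Sum>m. 2 * (real m + 1) * avoid U m n) \<le> (mean_hit n)\<^sup>2 + c * mean_hit n"
    using bound sm by (intro suminf_le_const)
qed

end

section \<open>Bounds from the total probability of a set of edges\<close>

context hitting
begin

text \<open>Every edge of \<open>A\<close> completes the target, so the time is dominated by a
  geometric variable with success probability \<open>sum p A\<close>. The hypothesis survives all
  other steps because \<open>U\<close> is up-closed.\<close>

lemma hit_le_inverse_rate:
  assumes "A \<subseteq> E" "A \<noteq> {}" and "\<And>e. e \<in> A \<Longrightarrow> U (bump e n)"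
  shows "hit U M n \<le> 1 / sum p A"
  using assms(3)
proof (induction M arbitrary: n)
  have q: "0 < sum p A"
    using assms(1,2) finite_E p_pos by (intro sum_pos) (auto dest: finite_subset)
  {
    case 0
    then show ?case using q by (simp add: hit_def)
  next
    case (Suc M)
    have "hit U M (bump e n) \<le> (if e \<in> A then 0 else 1 / sum p A)" if "e \<in> E" for e
    proof (cases "e \<in> A")
      case True
      then show ?thesis using Suc.prems by (simp add: hit_on)
    next
      case False
      have "U (bump e' (bump e n))" if "e' \<in> A" for e'
        using up_bump[OF Suc.prems[OF that], of e] by (simp add: bump_commute[of e'])
      then show ?thesis using Suc.IH False by simp
    qed
    then have "hit U (Suc M) n \<le> 1 + (\<Sum>e\<in>E. p e * (if e \<in> A then 0 else 1 / sum p A))"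
      unfolding hit_Suc by (intro add_mono average_mono) auto
    also have "(\<Sum>e\<in>E. p e * (if e \<in> A then 0 else 1 / sum p A)) = sum p (E - A) / sum p A"
      using finite_E by (simp add: if_distrib sum.If_cases sum_divide_distrib Diff_eq cong: if_cong)
    also have "\<dots> = (1 - sum p A) / sum p A"
      using assms(1) finite_E by (simp add: sum_diff sum_p)
    also have "1 + \<dots> = 1 / sum p A" using q by (simp add: field_simps)
    finally show ?case .
  }
qed

end

context recurrent_hitting
begin

text \<open>A step lands in \<open>A\<close> with probability \<open>sum p A\<close>, and
  \<open>U\<close> requires \<open>k\<close> such steps. The subsolution is the number of missing
  copies divided by this probability; truncated subtraction makes it 0 on \<open>U\<close>.\<close>

lemma mean_hit_ge_rate:
  assumes "A \<subseteq> E" "A \<noteq> {}" and "\<And>n. U n \<Longrightarrow> k \<le> sum n A"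
  shows "real k / sum p A \<le> mean_hit (\<lambda>_. 0)"
proof -
  have A: "finite A" using assms finite_E by (auto dest: finite_subset)
  have q: "0 < sum p A"
    using assms(1,2) A p_pos by (intro sum_pos) auto
  let ?B = "\<lambda>n. real (k - sum n A) / sum p A"
  have "?B (\<lambda>_. 0) \<le> mean_hit (\<lambda>_. 0) + 0"
  proof (rule subsolution_le_mean_hit)
    fix n
    show "?B n \<le> 0 + real k / sum p A" using q by (auto intro!: divide_right_mono)
    show "?B n \<le> 0" if "U n" using assms(3)[OF that] by simp
    have "?B n - (if e \<in> A then 1 / sum p A else 0) \<le> ?B (bump e n)" for e
    proof (cases "e \<in> A")
      case True
      then have "sum (bump e n) A = Suc (sum n A)"
        using A by (simp add: sum.remove[of A e] bump_def)
      then have "real (k - sum n A) - 1 \<le> real (k - sum (bump e n) A)" by simp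
      from divide_right_mono[OF this, of "sum p A"] q True show ?thesis
        by (simp add: diff_divide_distrib)
    next
      case False
      then have "sum (bump e n) A = sum n A" by (intro sum.cong) (auto simp: bump_def)
      then show ?thesis using False by simp
    qed
    then have "(\<Sum>e\<in>E. p e * (?B n - (if e \<in> A then 1 / sum p A else 0))) \<le> (\<Sum>e\<in>E. p e * ?B (bump e n))"
      by (intro average_mono)
    also have "(\<Sum>e\<in>E. p e * (?B n - (if e \<in> A then 1 / sum p A else 0))) =
        ?B n - (\<Sum>e\<in>E. if e \<in> A then p e / sum p A else 0)"
      unfolding right_diff_distrib sum_subtractf average_const by (simp add: if_distrib cong: if_cong)
    also have "(\<Sum>e\<in>E. if e \<in> A then p e / sum p A else 0) = sum p A / sum p A"
      using assms(1) finite_E by (simp add: sum.inter_restrict[symmetric] Int_absorb1 sum_divide_distrib[symmetric])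
    also have "\<dots> = 1" using q by simp
    finally show "?B n \<le> 1 + (\<Sum>e\<in>E. p e * ?B (bump e n))" by simp
  qed (use q in simp)
  then show ?thesis by simp
qed

lemma mean_hit_le_start: "mean_hit n \<le> mean_hit (\<lambda>_. 0)"
  unfolding mean_hit_def
proof (rule suminf_le[OF _ summable_avoid summable_avoid])
  show "avoid U m n \<le> avoid U m (\<lambda>_. 0)" for m
    using avoid_compare[of U U n m "\<lambda>_. 0"] up by simp
qed

end

section \<open>The walk in Poisson time\<close>

text \<open>The strict and the weak version agree because a single point is null. Both are kept
  because the layer-cake formula squeezes \<open>Q\<close> between them; \<open>x = top\<close> is
  included since a hitting time may be infinite.\<close>

lemma ennreal_power_eq_nn_integral:
  fixes x :: ennreal
  shows "(\<integral>\<^sup>+t. (if 0 \<le> t \<and> ennreal t < x then ennreal (real (Suc j) * t ^ j) else 0) \<partial>lborel) = x ^ Suc j"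
    (is "?I = _")
    and "(\<integral>\<^sup>+t. (if 0 \<le> t \<and> ennreal t \<le> x then ennreal (real (Suc j) * t ^ j) else 0) \<partial>lborel) = x ^ Suc j"
    (is "?J = _")
proof -
  have *: "(\<integral>\<^sup>+t. ennreal (real (Suc j) * t ^ j) * indicator {0..a} t \<partial>lborel) = ennreal (a ^ Suc j)"
    if "0 \<le> a" for a :: real
    using that
    by (subst nn_integral_FTC_Icc[where F = "\<lambda>t. t ^ Suc j"])
       (auto intro!: derivative_eq_intros simp del: power_Suc)
  have **: "(\<integral>\<^sup>+t. (if 0 \<le> t \<and> t < a then ennreal (real (Suc j) * t ^ j) else 0) \<partial>lborel) = ennreal (a ^ Suc j)"
    if "0 \<le> a" for a :: real
    unfolding *[OF that, symmetric]
    using AE_lborel_singleton[of a]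
    by (intro nn_integral_cong_AE) (auto elim!: eventually_mono simp: indicator_def)
  have "?I = x ^ Suc j \<and> ?J = x ^ Suc j"
  proof (cases x)
    case (real a)
    have "?I = (\<integral>\<^sup>+t. (if 0 \<le> t \<and> t < a then ennreal (real (Suc j) * t ^ j) else 0) \<partial>lborel)"
      using real by (intro nn_integral_cong) (auto simp: ennreal_less_iff)
    moreover have "?J = (\<integral>\<^sup>+t. ennreal (real (Suc j) * t ^ j) * indicator {0..a} t \<partial>lborel)"
      using real by (intro nn_integral_cong) (auto simp: indicator_def)
    ultimately show ?thesis using real * ** by (simp add: ennreal_power del: power_Suc)
  next
    case top
    \<comment> \<open>Any \<open>a \<ge> 1\<close> is a lower bound of the integral, because
      \<open>a \<le> a ^ Suc j\<close> and the latter is the part of the integral below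
      \<open>a\<close>.\<close>
    have ge: "ennreal a \<le> ?I" if "1 \<le> a" for a :: real
    proof -
      have "a \<le> a ^ Suc j" using that self_le_power[of a "Suc j"] by simp
      then have "ennreal a \<le> ennreal (a ^ Suc j)" by (intro ennreal_leI)
      also have "\<dots> = (\<integral>\<^sup>+t. (if 0 \<le> t \<and> t < a then ennreal (real (Suc j) * t ^ j) else 0) \<partial>lborel)"
        using that by (simp add: ** del: power_Suc)
      also have "\<dots> \<le> ?I" using top by (intro nn_integral_mono) auto
      finally show ?thesis .
    qed
    have "?I = top"
    proof (rule ccontr)
      assume "?I \<noteq> top"
      then obtain b where b: "?I = ennreal b" "0 \<le> b" by (cases ?I) auto
      with ge[of "b + 1"] show False by (simp add: ennreal_le_iff2)
    qed
    moreover have "?J = ?I" using top by (intro nn_integral_cong) auto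
    ultimately show ?thesis using top by simp
  qed
  then show "?I = x ^ Suc j" "?J = x ^ Suc j" by auto
qed

text \<open>Only the sandwich is assumed because \<^term>\<open>Q t\<close> will be the probability of an event
  that may differ from \<^term>\<open>t < T \<omega>\<close> when \<^term>\<open>t = T \<omega>\<close>.\<close>

lemma (in sigma_finite_measure) nn_integral_power_layer_cake:
  assumes T[measurable]: "T \<in> borel_measurable M"
    and le: "\<And>t. 0 < t \<Longrightarrow> emeasure M {\<omega>\<in>space M. ennreal t < T \<omega>} \<le> Q t"
    and ge: "\<And>t. 0 < t \<Longrightarrow> Q t \<le> emeasure M {\<omega>\<in>space M. ennreal t \<le> T \<omega>}"
  shows "(\<integral>\<^sup>+\<omega>. T \<omega> ^ Suc j \<partial>M) =
    (\<integral>\<^sup>+t. (if 0 < t then ennreal (real (Suc j) * t ^ j) * Q t else 0) \<partial>lborel)"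
proof -
  interpret P: pair_sigma_finite M lborel ..
  let ?g = "\<lambda>t. ennreal (real (Suc j) * t ^ j)"
  \<comment> \<open>The sandwich says nothing about \<open>t = 0\<close>, so this null set has to be
    removed.\<close>
  have pos: "AE t in lborel. (0 \<le> t) = (0 < (t::real))"
    using AE_lborel_singleton[of 0] by eventually_elim auto
  have inner1: "(\<integral>\<^sup>+\<omega>. (if 0 \<le> t \<and> ennreal t < T \<omega> then ?g t else 0) \<partial>M) =
      (if 0 \<le> t then ?g t * emeasure M {\<omega>\<in>space M. ennreal t < T \<omega>} else 0)" for t
  proof (cases "0 \<le> t")
    case True
    have "(\<integral>\<^sup>+\<omega>. (if 0 \<le> t \<and> ennreal t < T \<omega> then ?g t else 0) \<partial>M) =
        (\<integral>\<^sup>+\<omega>. ?g t * indicator {\<omega>\<in>space M. ennreal t < T \<omega>} \<omega> \<partial>M)"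
      using True by (intro nn_integral_cong) auto
    then show ?thesis using True by (simp add: nn_integral_cmult_indicator)
  qed simp
  have inner2: "(\<integral>\<^sup>+\<omega>. (if 0 \<le> t \<and> ennreal t \<le> T \<omega> then ?g t else 0) \<partial>M) =
      (if 0 \<le> t then ?g t * emeasure M {\<omega>\<in>space M. ennreal t \<le> T \<omega>} else 0)" for t
  proof (cases "0 \<le> t")
    case True
    have "(\<integral>\<^sup>+\<omega>. (if 0 \<le> t \<and> ennreal t \<le> T \<omega> then ?g t else 0) \<partial>M) =
        (\<integral>\<^sup>+\<omega>. ?g t * indicator {\<omega>\<in>space M. ennreal t \<le> T \<omega>} \<omega> \<partial>M)"
      using True by (intro nn_integral_cong) auto
    then show ?thesis using True by (simp add: nn_integral_cmult_indicator)
  qed simp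
  have "(\<integral>\<^sup>+\<omega>. T \<omega> ^ Suc j \<partial>M) =
      (\<integral>\<^sup>+\<omega>. (\<integral>\<^sup>+t. (if 0 \<le> t \<and> ennreal t < T \<omega> then ?g t else 0) \<partial>lborel) \<partial>M)"
    by (simp only: ennreal_power_eq_nn_integral)
  also have "\<dots> = (\<integral>\<^sup>+t. (\<integral>\<^sup>+\<omega>. (if 0 \<le> t \<and> ennreal t < T \<omega> then ?g t else 0) \<partial>M) \<partial>lborel)"
    by (rule P.Fubini'[symmetric]) measurable
  also have "\<dots> \<le> (\<integral>\<^sup>+t. (if 0 < t then ?g t * Q t else 0) \<partial>lborel)"
    unfolding inner1
  proof (rule nn_integral_mono_AE)
    show "AE t in lborel. (if 0 \<le> t then ?g t * emeasure M {\<omega>\<in>space M. ennreal t < T \<omega>} else 0)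
        \<le> (if 0 < t then ?g t * Q t else 0)"
      using pos by eventually_elim (auto intro!: mult_left_mono le)
  qed
  finally have upper: "(\<integral>\<^sup>+\<omega>. T \<omega> ^ Suc j \<partial>M) \<le> \<dots>" .
  have "(\<integral>\<^sup>+t. (if 0 < t then ?g t * Q t else 0) \<partial>lborel) \<le>
      (\<integral>\<^sup>+t. (\<integral>\<^sup>+\<omega>. (if 0 \<le> t \<and> ennreal t \<le> T \<omega> then ?g t else 0) \<partial>M) \<partial>lborel)"
    unfolding inner2 by (intro nn_integral_mono) (auto intro!: mult_left_mono ge)
  also have "\<dots> = (\<integral>\<^sup>+\<omega>. (\<integral>\<^sup>+t. (if 0 \<le> t \<and> ennreal t \<le> T \<omega> then ?g t else 0) \<partial>lborel) \<partial>M)"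
    by (rule P.Fubini') measurable
  also have "\<dots> = (\<integral>\<^sup>+\<omega>. T \<omega> ^ Suc j \<partial>M)"
    by (simp only: ennreal_power_eq_nn_integral)
  finally show ?thesis using upper by (intro antisym)
qed

text \<open>\<open>pmf (poisson_pmf (W * t)) m\<close> is \<open>1 / W\<close> times the Erlang
  density of the \<open>(m + 1)\<close>-st arrival time, so the integral is an Erlang
  moment.\<close>

lemma nn_integral_power_poisson:
  assumes "0 < W"
  shows "(\<integral>\<^sup>+t. (if 0 < t then ennreal (t ^ j) * ennreal (pmf (poisson_pmf (W * t)) m) else 0) \<partial>lborel)
    = ennreal (fact (m + j) / (fact m * W ^ Suc j))"
proof -
  have "(\<integral>\<^sup>+t. (if 0 < t then ennreal (t ^ j) * ennreal (pmf (poisson_pmf (W * t)) m) else 0) \<partial>lborel)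
      = (\<integral>\<^sup>+t. ennreal (1 / W) * ennreal (erlang_density m W t * t ^ j) \<partial>lborel)"
  proof (intro nn_integral_cong_AE)
    show "AE t in lborel. (if 0 < t then ennreal (t ^ j) * ennreal (pmf (poisson_pmf (W * t)) m) else 0)
        = ennreal (1 / W) * ennreal (erlang_density m W t * t ^ j)"
      using AE_lborel_singleton[of 0]
    proof eventually_elim
      case (elim t)
      then show ?case
        using \<open>0 < W\<close>
        by (auto simp: erlang_density_def ennreal_mult'[symmetric] power_mult_distrib mult_ac divide_simps
               intro!: arg_cong[where f = ennreal])
    qed
  qed
  also have "\<dots> = ennreal (1 / W) * ennreal (fact (m + j) / (fact m * W ^ j))"
    using \<open>0 < W\<close> by (simp add: nn_integral_cmult nn_integral_erlang_ith_moment)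
  also have "\<dots> = ennreal (fact (m + j) / (fact m * W ^ Suc j))"
    using \<open>0 < W\<close> by (simp add: ennreal_mult'[symmetric] mult_ac)
  finally show ?thesis .
qed

section \<open>Multinomial law of the walk and Poissonization\<close>

context random_walk
begin

definition step :: "'e pmf" where
  "step = embed_pmf (\<lambda>e. if e \<in> E then p e else 0)"

primrec walk :: "nat \<Rightarrow> ('e \<Rightarrow> nat) \<Rightarrow> ('e \<Rightarrow> nat) pmf" where
  "walk 0 n = return_pmf n"
| "walk (Suc m) n = bind_pmf step (\<lambda>e. walk m (bump e n))"

lemma pmf_step: "pmf step e = (if e \<in> E then p e else 0)"
  unfolding step_def
proof (rule pmf_embed_pmf)
  have "(\<integral>\<^sup>+e. ennreal (if e \<in> E then p e else 0) \<partial>count_space UNIV)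
      = (\<Sum>e\<in>E. ennreal (if e \<in> E then p e else 0))"
    by (rule nn_integral_count_space'[OF finite_E]) auto
  also have "\<dots> = ennreal (sum p E)"
    by (subst sum_ennreal[symmetric]) (auto simp: p_nonneg)
  finally show "(\<integral>\<^sup>+e. ennreal (if e \<in> E then p e else 0) \<partial>count_space UNIV) = 1"
    by (simp add: sum_p)
qed (simp add: p_nonneg)

lemma set_step: "set_pmf step = E"
  using p_pos by (auto simp: set_pmf_eq pmf_step) force

lemma emeasure_walk: "emeasure (walk m n) {n. \<not> U n} = ennreal (avoid U m n)"
proof (induction m arbitrary: n)
  case 0
  then show ?case by (auto simp: indicator_def)
next
  case (Suc m)
  have "emeasure (walk (Suc m) n) {n. \<not> U n} =
      (\<Sum>e\<in>E. ennreal (avoid U m (bump e n)) * ennreal (p e))"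
    using finite_E
    by (simp add: Suc nn_integral_measure_pmf_finite set_step pmf_step)
  also have "\<dots> = ennreal (avoid U (Suc m) n)"
    by (simp add: ennreal_mult'[symmetric] avoid_nonneg p_nonneg mult.commute)
  finally show ?case .
qed

lemma set_walk: "n' \<in> set_pmf (walk m n) \<Longrightarrow> n e \<le> n' e \<and> (e \<notin> E \<longrightarrow> n' e = n e)"
proof (induction m arbitrary: n)
  case (Suc m)
  then obtain e' where "e' \<in> E" and e': "n' \<in> set_pmf (walk m (bump e' n))"
    by (auto simp: set_step)
  from Suc.IH[OF e'] \<open>e' \<in> E\<close> show ?case
    by (cases "e = e'") (auto simp: bump_def)
qed auto

text \<open>The multinomial law follows by conditioning on the first edge \<open>e\<close>: the
  increment loses one copy of \<open>e\<close>, which contributes the factor \<open>d e\<close>, and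
  these factors add up to \<open>Suc m\<close> and turn \<open>fact m\<close> into
  \<open>fact (Suc m)\<close>. The start \<open>n\<close> is arbitrary for the sake of the
  induction.\<close>

lemma pmf_walk:
  assumes "\<And>e. e \<notin> E \<Longrightarrow> d e = 0"
  shows "pmf (walk m n) (\<lambda>e. n e + d e) =
    (if sum d E = m then fact m * (\<Prod>e\<in>E. p e ^ d e / fact (d e)) else 0)"
  using assms
proof (induction m arbitrary: n d)
  case 0
  have "d = (\<lambda>_. 0)" if "sum d E = 0"
    using that 0 finite_E by auto
  moreover have "n = (\<lambda>e. n e + d e) \<longleftrightarrow> d = (\<lambda>_. 0)"
    by (auto simp: fun_eq_iff)
  ultimately show ?case by (auto simp: indicator_def)
next
  case (Suc m)
  let ?P = "\<lambda>d. \<Prod>e\<in>E. p e ^ d e / fact (d e)"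
  have one: "p e * pmf (walk m (bump e n)) (\<lambda>x. n x + d x) =
      (if sum d E = Suc m then fact m * (real (d e) * ?P d) else 0)" if "e \<in> E" for e
  proof (cases "d e")
    case 0
    \<comment> \<open>An increment without copies of \<open>e\<close> cannot begin with a step along
      \<open>e\<close>.\<close>
    then have "(\<lambda>x. n x + d x) \<notin> set_pmf (walk m (bump e n))"
      using set_walk[of "\<lambda>x. n x + d x" m "bump e n" e] by (auto simp: bump_def)
    then show ?thesis using 0 by (simp add: set_pmf_iff)
  next
    case (Suc c)
    define d' where "d' = d(e := c)"
    have shift: "(\<lambda>x. n x + d x) = (\<lambda>x. bump e n x + d' x)"
      using Suc by (auto simp: bump_def d'_def)
    have sum: "sum d E = Suc (sum d' E)"
      using finite_E that Suc by (simp add: sum.remove d'_def)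
    have prod: "p e * ?P d' = real (d e) * ?P d"
    proof -
      have "p e * (p e ^ c / fact c) = real (Suc c) * (p e ^ Suc c / fact (Suc c))"
        by (simp add: fact_Suc del: of_nat_Suc)
      then show ?thesis
        using finite_E that Suc by (simp add: prod.remove d'_def mult.assoc[symmetric])
    qed
    have "pmf (walk m (bump e n)) (\<lambda>x. n x + d x) = (if sum d' E = m then fact m * ?P d' else 0)"
      unfolding shift using Suc.prems that by (intro Suc.IH) (auto simp: d'_def)
    then show ?thesis using sum prod by (auto simp: mult.left_commute)
  qed
  have "pmf (walk (Suc m) n) (\<lambda>x. n x + d x) = (\<Sum>e\<in>E. p e * pmf (walk m (bump e n)) (\<lambda>x. n x + d x))"
    by (simp add: pmf_bind, subst integral_measure_pmf_real[OF finite_E])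
       (auto simp: set_step pmf_step mult.commute)
  also have "\<dots> = (\<Sum>e\<in>E. if sum d E = Suc m then fact m * (real (d e) * ?P d) else 0)"
    by (intro sum.cong refl one)
  also have "\<dots> = (if sum d E = Suc m then fact m * (real (sum d E) * ?P d) else 0)"
    unfolding of_nat_sum sum_distrib_right sum_distrib_left by simp
  finally show ?case by simp
qed

text \<open>Poissonization: sorting a Poisson number of independent steps by edge gives independent
  Poisson counts. Off \<open>E\<close> both laws are concentrated on 0.\<close>

lemma Pi_pmf_poisson_eq_walk:
  assumes "0 < r"
  shows "Pi_pmf E 0 (\<lambda>e. poisson_pmf (r * p e)) = bind_pmf (poisson_pmf r) (\<lambda>m. walk m (\<lambda>_. 0))"
proof (rule pmf_eqI)
  fix d :: "'e \<Rightarrow> nat"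
  let ?P = "\<Prod>e\<in>E. p e ^ d e / fact (d e)"
  show "pmf (Pi_pmf E 0 (\<lambda>e. poisson_pmf (r * p e))) d
      = pmf (bind_pmf (poisson_pmf r) (\<lambda>m. walk m (\<lambda>_. 0))) d"
  proof (cases "\<forall>e. e \<notin> E \<longrightarrow> d e = 0")
    case True
    have "pmf (Pi_pmf E 0 (\<lambda>e. poisson_pmf (r * p e))) d =
        (\<Prod>e\<in>E. (r ^ d e * exp (- (r * p e))) * (p e ^ d e / fact (d e)))"
      using True \<open>0 < r\<close> p_pos finite_E
      by (subst pmf_Pi') (auto simp: power_mult_distrib intro!: prod.cong)
    also have "\<dots> = r ^ sum d E * exp (- r) * ?P"
      unfolding prod.distrib
      using finite_E by (simp add: power_sum exp_sum[symmetric] sum_negf sum_distrib_left[symmetric] sum_p)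
    also have "\<dots> = pmf (poisson_pmf r) (sum d E) * (fact (sum d E) * ?P)"
      using \<open>0 < r\<close> by simp
    also have "\<dots> = (\<integral>m. pmf (walk m (\<lambda>_. 0)) d \<partial>poisson_pmf r)"
      using True pmf_walk[of d _ "\<lambda>_. 0"]
      by (subst integral_measure_pmf_real[of "{sum d E}"]) (auto split: if_splits)
    finally show ?thesis by (simp add: pmf_bind)
  next
    case False
    then obtain e where "e \<notin> E" "d e \<noteq> 0" by auto
    then have "d \<notin> set_pmf (bind_pmf (poisson_pmf r) (\<lambda>m. walk m (\<lambda>_. 0)))"
      using set_walk[of d _ "\<lambda>_. 0" e] by auto
    then have "pmf (bind_pmf (poisson_pmf r) (\<lambda>m. walk m (\<lambda>_. 0))) d = 0"
      by (rule iffD2[OF pmf_eq_0_set_pmf])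
    moreover have "pmf (Pi_pmf E 0 (\<lambda>e. poisson_pmf (r * p e))) d = 0"
      using False finite_E by (intro pmf_Pi_outside) auto
    ultimately show ?thesis by simp
  qed
qed

end

text \<open>The counts at a fixed time lie in the countable support of the product law, so the event
  is a countable union of fibers. This gives measurability for an arbitrary predicate
  \<open>U\<close>. The value 0 off \<open>E\<close> is the default of
  \<open>Pi_pmf\<close>.\<close>

lemma emeasure_indep_poisson:
  fixes N :: "'e \<Rightarrow> real \<Rightarrow> 'a \<Rightarrow> nat" and r :: "'e \<Rightarrow> real"
  assumes "prob_space M" and E: "finite E" "E \<noteq> {}" and r: "\<And>e. e \<in> E \<Longrightarrow> 0 < r e"
    and indep: "indep_poisson_processes M E r N" and t: "0 < t"
  defines "X \<equiv> \<lambda>\<omega> e. if e \<in> E then N e t \<omega> else 0"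
  shows "{\<omega>\<in>space M. U (X \<omega>)} \<in> sets M"
    and "emeasure M {\<omega>\<in>space M. U (X \<omega>)} =
      emeasure (Pi_pmf E 0 (\<lambda>e. poisson_pmf (r e * t))) {n. U n}"
proof -
  interpret prob_space M by fact
  let ?Q = "Pi_pmf E 0 (\<lambda>e. poisson_pmf (r e * t))"
  define I where "I = set_pmf ?Q"
  have pp: "poisson_process M (r e) (N e)" if "e \<in> E" for e
    using indep that by (auto simp: indep_poisson_processes_def)
  have [measurable]: "N e t \<in> measurable M (count_space UNIV)" if "e \<in> E" for e
    using pp[OF that] t by (auto simp: poisson_process_def)
  have I: "I = PiE_dflt E 0 (\<lambda>_. UNIV)"
    unfolding I_def using E t r by (simp add: set_Pi_pmf PiE_dflt_def)
  have X_I: "X \<omega> \<in> I" for \<omega>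
    by (auto simp: I X_def PiE_dflt_def)
  have "indep_vars (\<lambda>_. PiM {0..} (\<lambda>_. count_space UNIV)) (\<lambda>e \<omega>. \<lambda>t\<in>{0..}. N e t \<omega>) E"
    using indep by (simp add: indep_poisson_processes_def)
  \<comment> \<open>Evaluation at \<open>t\<close> is measurable on the path space, so independence
    of the processes passes to the counts at time \<open>t\<close>.\<close>
  then have "indep_vars (\<lambda>_. count_space UNIV) (\<lambda>e \<omega>. (\<lambda>s\<in>{0..}. N e s \<omega>) t) E"
    by (rule indep_vars_compose2) (use t in \<open>auto intro: measurable_component_singleton\<close>)
  then have iv: "indep_vars (\<lambda>_. count_space UNIV) (\<lambda>e \<omega>. N e t \<omega>) E"
    using t by (simp cong: indep_vars_cong)
  have marginal: "prob (N e t -` {j} \<inter> space M) = pmf (poisson_pmf (r e * t)) j" if "e \<in> E" for e j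
  proof -
    \<comment> \<open>The count at \<open>t\<close> is the increment from time 0, where every path
      is 0.\<close>
    have "distr M (count_space UNIV) (\<lambda>\<omega>. N e t \<omega> - N e 0 \<omega>) = measure_pmf (poisson_pmf (r e * (t - 0)))"
      using pp[OF that] t unfolding poisson_process_def by blast
    moreover have "distr M (count_space UNIV) (\<lambda>\<omega>. N e t \<omega> - N e 0 \<omega>) = distr M (count_space UNIV) (N e t)"
      using pp[OF that] by (intro distr_cong) (auto simp: poisson_process_def)
    ultimately have "distr M (count_space UNIV) (N e t) = measure_pmf (poisson_pmf (r e * t))"
      by simp
    then have "measure (distr M (count_space UNIV) (N e t)) {j} = pmf (poisson_pmf (r e * t)) j"
      by (simp add: measure_pmf_single)
    then show ?thesis using that by (simp add: measure_distr)
  qed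
  have fiber: "{\<omega>\<in>space M. X \<omega> = n} = (\<Inter>e\<in>E. N e t -` {n e} \<inter> space M)" if "n \<in> I" for n
    using that E by (auto simp: I X_def PiE_dflt_def fun_eq_iff)
  have fiber_sets[measurable]: "{\<omega>\<in>space M. X \<omega> = n} \<in> sets M" if "n \<in> I" for n
    unfolding fiber[OF that] using E by (intro sets.finite_INT) auto
  have fiber_prob: "emeasure M {\<omega>\<in>space M. X \<omega> = n} = ennreal (pmf ?Q n)" if "n \<in> I" for n
  proof -
    have "prob {\<omega>\<in>space M. X \<omega> = n} = (\<Prod>e\<in>E. prob (N e t -` {n e} \<inter> space M))"
      unfolding fiber[OF that] using iv E by (intro indep_varsD_finite) auto
    also have "\<dots> = pmf ?Q n"
      using that E by (subst pmf_Pi') (auto simp: marginal I PiE_dflt_def)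
    finally show ?thesis by (simp add: emeasure_eq_measure)
  qed
  let ?I = "{n\<in>I. U n}"
  have countable: "countable ?I"
    unfolding I_def by (rule countable_subset[OF _ countable_set_pmf]) auto
  have eq: "{\<omega>\<in>space M. U (X \<omega>)} = (\<Union>n\<in>?I. {\<omega>\<in>space M. X \<omega> = n})"
    using X_I by auto
  show "{\<omega>\<in>space M. U (X \<omega>)} \<in> sets M"
    unfolding eq using countable by (intro sets.countable_UN'') auto
  have "emeasure M {\<omega>\<in>space M. U (X \<omega>)} =
      (\<integral>\<^sup>+n. emeasure M {\<omega>\<in>space M. X \<omega> = n} \<partial>count_space ?I)"
    unfolding eq using countable
    by (intro emeasure_UN_countable) (auto simp: disjoint_family_on_def)
  also have "\<dots> = (\<integral>\<^sup>+n. ennreal (pmf ?Q n) \<partial>count_space ?I)"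
    by (intro nn_integral_cong) (auto simp: fiber_prob)
  also have "\<dots> = emeasure ?Q ?I" by (rule nn_integral_pmf)
  also have "\<dots> = emeasure ?Q {n. U n}"
    by (rule emeasure_eq_AE) (auto simp: AE_measure_pmf_iff I_def)
  finally show "emeasure M {\<omega>\<in>space M. U (X \<omega>)} = emeasure ?Q {n. U n}" .
qed

section \<open>Transfer to the continuous-time hitting time\<close>

context recurrent_hitting
begin

lemma E_nonempty: "E \<noteq> {}"
  using sum_p by auto

text \<open>The number of jumps by time \<open>t\<close> is Poisson with mean \<open>W * t\<close>,
  and given this number the counts are those of the walk.\<close>

lemma emeasure_avoid:
  fixes N :: "'a \<Rightarrow> real \<Rightarrow> 'b \<Rightarrow> nat"
  assumes "prob_space M" and "0 < W" and "indep_poisson_processes M E (\<lambda>e. W * p e) N" and "0 < t"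
  shows "emeasure M {\<omega>\<in>space M. \<not> U (\<lambda>e. if e \<in> E then N e t \<omega> else 0)} =
    (\<Sum>m. ennreal (pmf (poisson_pmf (W * t)) m) * ennreal (avoid U m (\<lambda>_. 0)))"
proof -
  have "emeasure M {\<omega>\<in>space M. \<not> U (\<lambda>e. if e \<in> E then N e t \<omega> else 0)} =
      emeasure (Pi_pmf E 0 (\<lambda>e. poisson_pmf (W * p e * t))) {n. \<not> U n}"
    using assms finite_E E_nonempty p_pos by (intro emeasure_indep_poisson) auto
  also have "(\<lambda>e. poisson_pmf (W * p e * t)) = (\<lambda>e. poisson_pmf (W * t * p e))"
    by (simp add: mult_ac)
  also have "emeasure (Pi_pmf E 0 \<dots>) {n. \<not> U n} =
      (\<integral>\<^sup>+m. ennreal (avoid U m (\<lambda>_. 0)) \<partial>measure_pmf (poisson_pmf (W * t)))"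
    using \<open>0 < W\<close> \<open>0 < t\<close> by (simp add: Pi_pmf_poisson_eq_walk emeasure_walk)
  also have "\<dots> = (\<Sum>m. ennreal (pmf (poisson_pmf (W * t)) m) * ennreal (avoid U m (\<lambda>_. 0)))"
    by (simp add: nn_integral_measure_pmf nn_integral_count_space_nat)
  finally show ?thesis .
qed

text \<open>Counts off \<open>E\<close> are set to 0 because \<open>N e\<close> is constrained only
  for \<open>e \<in> E\<close>; the walk from 0 stays at 0 there as well.\<close>

definition hitting_time :: "('a \<Rightarrow> real \<Rightarrow> 'b \<Rightarrow> nat) \<Rightarrow> 'b \<Rightarrow> ennreal" where
  "hitting_time N \<omega> = (INF t\<in>{t. 0 \<le> t \<and> U (\<lambda>e. if e \<in> E then N e t \<omega> else 0)}. ennreal t)"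

context
  fixes M :: "'b measure" and N :: "'a \<Rightarrow> real \<Rightarrow> 'b \<Rightarrow> nat" and W :: real
  assumes M: "prob_space M" and W: "0 < W" and N: "indep_poisson_processes M E (\<lambda>e. W * p e) N"
    and start: "\<not> U (\<lambda>_. 0)"
begin

abbreviation (input) counts :: "real \<Rightarrow> 'b \<Rightarrow> 'a \<Rightarrow> nat" where
  "counts t \<omega> \<equiv> \<lambda>e. if e \<in> E then N e t \<omega> else 0"

lemma counts_mono:
  assumes "\<omega> \<in> space M" "0 \<le> s" "s \<le> t" "U (counts s \<omega>)"
  shows "U (counts t \<omega>)"
proof (rule up[OF assms(4)])
  fix e
  show "counts s \<omega> e \<le> counts t \<omega> e"
  proof (cases "e \<in> E")
    case True
    then have "mono_on {0..} (\<lambda>t. N e t \<omega>)"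
      using N \<open>\<omega> \<in> space M\<close> by (auto simp: indep_poisson_processes_def poisson_process_def)
    then show ?thesis using assms by (auto simp: mono_on_def)
  qed simp
qed

text \<open>Rational witnesses turn the event into a countable union. As paths are monotone, a time
  of success can be increased to a rational one, which is then positive, as
  \<open>counts_sets\<close> requires.\<close>

lemma hitting_time_less_iff:
  assumes "\<omega> \<in> space M"
  shows "hitting_time N \<omega> < x \<longleftrightarrow>
    (\<exists>q\<in>\<rat>. 0 < q \<and> ennreal q < x \<and> U (counts q \<omega>))"
proof
  assume "hitting_time N \<omega> < x"
  then obtain s where s: "0 \<le> s" "U (counts s \<omega>)" "ennreal s < x"
    by (auto simp: hitting_time_def INF_less_iff)
  obtain q where q: "q \<in> \<rat>" "s < q" "ennreal q < x"
  proof (cases x)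
    case (real a)
    then have "s < a" using s by (simp add: ennreal_less_iff)
    then obtain q where "q \<in> \<rat>" "s < q" "q < a" using Rats_dense_in_real by blast
    with that s real show ?thesis by (simp add: ennreal_less_iff)
  next
    case top
    obtain q where "q \<in> \<rat>" "s < q" using Rats_dense_in_real[of s "s + 1"] by auto
    with that top show ?thesis by simp
  qed
  with s counts_mono[OF assms, of s q] show "\<exists>q\<in>\<rat>. 0 < q \<and> ennreal q < x \<and> U (counts q \<omega>)"
    by (intro bexI[of _ q]) auto
next
  assume "\<exists>q\<in>\<rat>. 0 < q \<and> ennreal q < x \<and> U (counts q \<omega>)"
  then obtain q where "0 < q" "ennreal q < x" "U (counts q \<omega>)" by auto
  then show "hitting_time N \<omega> < x"
    by (auto simp: hitting_time_def INF_less_iff intro!: exI[of _ q])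
qed

lemma counts_sets: "0 < t \<Longrightarrow> {\<omega>\<in>space M. U (counts t \<omega>)} \<in> sets M"
  using M W N finite_E E_nonempty p_pos by (intro emeasure_indep_poisson) auto

lemma borel_measurable_hitting_time: "hitting_time N \<in> borel_measurable M"
proof (rule borel_measurableI_less)
  fix x
  have "{\<omega>\<in>space M. hitting_time N \<omega> < x} =
      (\<Union>q\<in>{q\<in>\<rat>. 0 < q \<and> ennreal q < x}. {\<omega>\<in>space M. U (counts q \<omega>)})"
    using hitting_time_less_iff by auto
  also have "\<dots> \<in> sets M"
    by (intro sets.countable_UN'' countable_subset[OF _ countable_rat] counts_sets) auto
  finally show "{\<omega>\<in>space M. hitting_time N \<omega> < x} \<in> sets M" .
qed

text \<open>The layer-cake formula writes the moment as an integral of tail probabilities,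
  \<open>emeasure_avoid\<close> expands these into Poisson weights, and each weight integrates to an
  Erlang moment.\<close>

lemma nn_integral_hitting_time_power:
  "(\<integral>\<^sup>+\<omega>. hitting_time N \<omega> ^ Suc j \<partial>M) =
    (\<Sum>m. ennreal (avoid U m (\<lambda>_. 0) * real (Suc j) * (fact (m + j) / (fact m * W ^ Suc j))))"
proof -
  interpret prob_space M by (rule M)
  have [measurable]: "hitting_time N \<in> borel_measurable M"
    by (rule borel_measurable_hitting_time)
  have meas: "(\<lambda>t. if 0 < t then ennreal (t ^ j) * ennreal (pmf (poisson_pmf (W * t)) m) else 0)
      \<in> borel_measurable lborel" for m
  proof -
    have *: "(\<lambda>t. if 0 < t then ennreal (t ^ j) * ennreal (pmf (poisson_pmf (W * t)) m) else 0) =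
        (\<lambda>t. if 0 < t then ennreal (t ^ j) * ennreal ((W * t) ^ m / fact m * exp (- (W * t))) else 0)"
      using W by (auto simp: fun_eq_iff)
    show ?thesis unfolding * by measurable
  qed
  let ?Q = "\<lambda>t. emeasure M {\<omega>\<in>space M. \<not> U (counts t \<omega>)}"
  have sets: "{\<omega>\<in>space M. \<not> U (counts t \<omega>)} \<in> sets M" if "0 < t" for t
    using sets.Diff[OF sets.top counts_sets[OF that]]
    by (rule back_subst[where P = "\<lambda>A. A \<in> sets M"]) auto
  have "(\<integral>\<^sup>+\<omega>. hitting_time N \<omega> ^ Suc j \<partial>M) =
      (\<integral>\<^sup>+t. (if 0 < t then ennreal (real (Suc j) * t ^ j) * ?Q t else 0) \<partial>lborel)"
  proof (rule nn_integral_power_layer_cake)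
    fix t :: real assume "0 < t"
    have "\<not> U (counts t \<omega>)" if "ennreal t < hitting_time N \<omega>" for \<omega>
    proof
      assume "U (counts t \<omega>)"
      then have "hitting_time N \<omega> \<le> ennreal t"
        unfolding hitting_time_def using \<open>0 < t\<close> by (intro INF_lower) auto
      with that show False by simp
    qed
    then show "emeasure M {\<omega>\<in>space M. ennreal t < hitting_time N \<omega>} \<le> ?Q t"
      using sets[OF \<open>0 < t\<close>] by (intro emeasure_mono) auto
    have "ennreal t \<le> hitting_time N \<omega>" if "\<omega> \<in> space M" "\<not> U (counts t \<omega>)" for \<omega>
      unfolding hitting_time_def
    proof (rule INF_greatest)
      fix s assume "s \<in> {t. 0 \<le> t \<and> U (counts t \<omega>)}"
      then have "t \<le> s" using counts_mono[OF that(1), of s t] that(2) by (cases "t \<le> s") auto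
      then show "ennreal t \<le> ennreal s" by (rule ennreal_leI)
    qed
    then show "?Q t \<le> emeasure M {\<omega>\<in>space M. ennreal t \<le> hitting_time N \<omega>}"
      by (intro emeasure_mono) auto
  qed measurable
  also have "\<dots> = (\<integral>\<^sup>+t. (\<Sum>m. ennreal (avoid U m (\<lambda>_. 0) * real (Suc j)) *
      (if 0 < t then ennreal (t ^ j) * ennreal (pmf (poisson_pmf (W * t)) m) else 0)) \<partial>lborel)"
  proof (rule nn_integral_cong)
    fix t :: real
    show "(if 0 < t then ennreal (real (Suc j) * t ^ j) * ?Q t else 0) =
      (\<Sum>m. ennreal (avoid U m (\<lambda>_. 0) * real (Suc j)) *
      (if 0 < t then ennreal (t ^ j) * ennreal (pmf (poisson_pmf (W * t)) m) else 0))"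
    proof (cases "0 < t")
      case True
      then show ?thesis
        unfolding if_P[OF True] emeasure_avoid[OF M W N True] ennreal_suminf_cmult[symmetric]
        by (intro suminf_cong) (simp add: ennreal_mult' avoid_nonneg mult_ac del: of_nat_Suc)
    qed simp
  qed
  also have "\<dots> = (\<Sum>m. \<integral>\<^sup>+t. ennreal (avoid U m (\<lambda>_. 0) * real (Suc j)) *
      (if 0 < t then ennreal (t ^ j) * ennreal (pmf (poisson_pmf (W * t)) m) else 0) \<partial>lborel)"
    by (intro nn_integral_suminf borel_measurable_times_ennreal borel_measurable_const meas)
  also have "\<dots> = (\<Sum>m. ennreal (avoid U m (\<lambda>_. 0) * real (Suc j)) *
      ennreal (fact (m + j) / (fact m * W ^ Suc j)))"
    by (simp only: nn_integral_cmult meas nn_integral_power_poisson[OF W])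
  also have "\<dots> = (\<Sum>m. ennreal (avoid U m (\<lambda>_. 0) * real (Suc j) *
      (fact (m + j) / (fact m * W ^ Suc j))))"
    using W by (intro suminf_cong ennreal_mult[symmetric]) (auto intro: mult_nonneg_nonneg avoid_nonneg)
  finally show ?thesis .
qed

text \<open>With \<open>h = mean_hit (\<lambda>_. 0)\<close>, the mean is \<open>h / W\<close>, and
  the second moment is the expectation of K (K + 1) divided by \<open>W\<^sup>2\<close>. By
  \<open>second_moment_le\<close> the variance is then at most
  \<open>c * h / W\<^sup>2\<close>.\<close>

lemma hitting_time_concentration:
  assumes jump: "\<And>n e m. e \<in> E \<Longrightarrow> U (bump e n) \<Longrightarrow> hit U m n \<le> c" and "1 \<le> c"
  shows "finite_second_moment M (hitting_time N)"
    and "0 < mean M (hitting_time N)"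
    and "sd M (hitting_time N) / mean M (hitting_time N) \<le> sqrt (c / mean_hit (\<lambda>_. 0))"
proof -
  interpret prob_space M by (rule M)
  let ?T = "hitting_time N" and ?h = "mean_hit (\<lambda>_. 0)"
  let ?S = "\<Sum>m. 2 * (real m + 1) * avoid U m (\<lambda>_. 0)"
  have [measurable]: "?T \<in> borel_measurable M"
    by (rule borel_measurable_hitting_time)
  have h: "1 \<le> ?h" using start by (rule mean_hit_ge_1)
  have "(\<integral>\<^sup>+\<omega>. ?T \<omega> \<partial>M) = (\<Sum>m. ennreal (avoid U m (\<lambda>_. 0) / W))"
    using nn_integral_hitting_time_power[of 0] by simp
  also have "\<dots> = ennreal (?h / W)"
    using summable_avoid W unfolding mean_hit_def
    by (subst suminf_ennreal2) (auto intro: summable_divide divide_nonneg_pos avoid_nonneg simp: suminf_divide)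
  finally have first: "(\<integral>\<^sup>+\<omega>. ?T \<omega> \<partial>M) = ennreal (?h / W)" .
  have S: "summable (\<lambda>m. 2 * (real m + 1) * avoid U m (\<lambda>_. 0))"
    and S_le: "?S \<le> ?h\<^sup>2 + c * ?h"
    using second_moment_le[OF jump \<open>1 \<le> c\<close>] by auto
  have "(\<integral>\<^sup>+\<omega>. (?T \<omega>)\<^sup>2 \<partial>M) = (\<Sum>m. ennreal (2 * (real m + 1) * avoid U m (\<lambda>_. 0) / W\<^sup>2))"
  proof -
    \<comment> \<open>The quotient of factorials is \<open>m + 1\<close>, which produces exactly the
      weights of \<open>hit2\<close>.\<close>
    have "avoid U m (\<lambda>_. 0) * real (Suc 1) * (fact (m + 1) / (fact m * W ^ Suc 1)) =
        2 * (real m + 1) * avoid U m (\<lambda>_. 0) / W\<^sup>2" for m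
      using W by (simp add: power2_eq_square field_simps)
    then show ?thesis
      using nn_integral_hitting_time_power[of 1] by (simp only: numeral_2_eq_2 One_nat_def)
  qed
  also have "\<dots> = ennreal (?S / W\<^sup>2)"
    using S W
    by (subst suminf_ennreal2)
       (auto intro!: summable_divide divide_nonneg_pos mult_nonneg_nonneg avoid_nonneg simp: suminf_divide)
  finally have second: "(\<integral>\<^sup>+\<omega>. (?T \<omega>)\<^sup>2 \<partial>M) = ennreal (?S / W\<^sup>2)" .
  show "finite_second_moment M ?T"
    unfolding finite_second_moment_def using second by simp
  \<comment> \<open>A finite mean makes the hitting time finite almost surely, so
    \<open>enn2real\<close> does not change its moments.\<close>
  have fin: "AE \<omega> in M. ?T \<omega> = ennreal (enn2real (?T \<omega>))"
    using nn_integral_PInf_AE[of ?T M] first by (auto elim!: eventually_mono simp: less_top)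
  have T1: "(\<integral>\<^sup>+\<omega>. ennreal (enn2real (?T \<omega>)) \<partial>M) = ennreal (?h / W)"
    unfolding first[symmetric] using fin by (intro nn_integral_cong_AE) (auto elim: eventually_mono)
  have T2: "(\<integral>\<^sup>+\<omega>. ennreal ((enn2real (?T \<omega>))\<^sup>2) \<partial>M) = ennreal (?S / W\<^sup>2)"
    unfolding second[symmetric]
  proof (intro nn_integral_cong_AE)
    show "AE \<omega> in M. ennreal ((enn2real (?T \<omega>))\<^sup>2) = (?T \<omega>)\<^sup>2"
      using fin by eventually_elim (metis ennreal_power enn2real_nonneg)
  qed
  have S_nonneg: "0 \<le> ?S"
    using S by (intro suminf_nonneg) (auto intro: mult_nonneg_nonneg avoid_nonneg)
  have I1: "integrable M (\<lambda>\<omega>. enn2real (?T \<omega>))"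
    using T1 by (intro integrableI_nonneg) auto
  have I2: "integrable M (\<lambda>\<omega>. (enn2real (?T \<omega>))\<^sup>2)"
    using T2 by (intro integrableI_nonneg) auto
  have mean: "mean M ?T = ?h / W"
    unfolding mean_def using T1 h W by (subst integral_eq_nn_integral) auto
  have "expectation (\<lambda>\<omega>. (enn2real (?T \<omega>))\<^sup>2) = ?S / W\<^sup>2"
    using T2 S_nonneg by (subst integral_eq_nn_integral) auto
  then have "variance (\<lambda>\<omega>. enn2real (?T \<omega>)) = ?S / W\<^sup>2 - (?h / W)\<^sup>2"
    using variance_eq[OF I1 I2] mean by (simp add: mean_def)
  also have "\<dots> = (?S - ?h\<^sup>2) / W\<^sup>2"
    by (simp add: power_divide diff_divide_distrib)
  also have "\<dots> \<le> (c * ?h) / W\<^sup>2"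
    using S_le by (intro divide_right_mono) auto
  finally have "sd M ?T \<le> sqrt ((c * ?h) / W\<^sup>2)"
    unfolding sd_def by (rule real_sqrt_le_mono)
  also have "\<dots> = sqrt (c / ?h) * (?h / W)"
  proof -
    have "(c * ?h) / W\<^sup>2 = c / ?h * (?h / W)\<^sup>2"
      using h W by (simp add: power2_eq_square field_simps)
    then show ?thesis using h W by (simp only: real_sqrt_mult real_sqrt_abs) simp
  qed
  finally show "sd M ?T / mean M ?T \<le> sqrt (c / ?h)"
    using h W unfolding mean by (subst pos_divide_le_eq) auto
  show "0 < mean M ?T" using h W unfolding mean by simp
qed

end

end

section \<open>Edge-disjoint subgraphs\<close>

lemma edge_copies_mono: "(\<And>e. e \<in> E \<Longrightarrow> n e \<le> n' e) \<Longrightarrow> edge_copies E n \<subseteq> edge_copies E n'"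
  unfolding edge_copies_def by (force dest: order_less_le_trans)

lemma edge_copies_cong: "(\<And>e. e \<in> E \<Longrightarrow> n e = n' e) \<Longrightarrow> edge_copies E n = edge_copies E n'"
  by (auto simp: edge_copies_def)

lemma finite_edge_copies: "finite E \<Longrightarrow> finite (edge_copies E n)"
  by (simp add: edge_copies_def)

lemma edge_copies_bump:
  "e \<in> E \<Longrightarrow> edge_copies E (bump e n) = insert (e, n e) (edge_copies E n)"
  by (auto simp: edge_copies_def bump_def less_Suc_eq split: if_splits)

lemma not_in_edge_copies: "(e, n e) \<notin> edge_copies E n"
  by (simp add: edge_copies_def)

lemma contains_edge_disjoint_mono:
  "contains_edge_disjoint P k C \<Longrightarrow> C \<subseteq> C' \<Longrightarrow> contains_edge_disjoint P k C'"
  unfolding contains_edge_disjoint_def by blast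

lemma contains_edge_disjointI:
  assumes "\<And>i. i < k \<Longrightarrow> S i \<subseteq> C" and "\<And>i. i < k \<Longrightarrow> P (S i)"
    and "\<And>i j. i < k \<Longrightarrow> j < k \<Longrightarrow> i \<noteq> j \<Longrightarrow> S i \<inter> S j = {}"
  shows "contains_edge_disjoint P k C"
  unfolding contains_edge_disjoint_def disjoint_family_on_def using assms by (metis lessThan_iff)

lemma contains_edge_disjointE:
  assumes "contains_edge_disjoint P k C"
  obtains S where "\<And>i. i < k \<Longrightarrow> S i \<subseteq> C" and "\<And>i. i < k \<Longrightarrow> P (S i)"
    and "\<And>i j. i < k \<Longrightarrow> j < k \<Longrightarrow> i \<noteq> j \<Longrightarrow> S i \<inter> S j = {}"
  using assms unfolding contains_edge_disjoint_def disjoint_family_on_def by (metis lessThan_iff)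

text \<open>This is the exchange step: the member \<open>S j\<close> may leave \<open>C\<close>, for
  it is replaced by \<open>A\<close>.\<close>

lemma contains_edge_disjoint_update:
  assumes "\<And>i. i < k \<Longrightarrow> i \<noteq> j \<Longrightarrow> S i \<subseteq> C" and "\<And>i. i < k \<Longrightarrow> P (S i)"
    and "\<And>i j. i < k \<Longrightarrow> j < k \<Longrightarrow> i \<noteq> j \<Longrightarrow> S i \<inter> S j = {}"
    and "A \<subseteq> C" and "P A" and "\<And>i. i < k \<Longrightarrow> i \<noteq> j \<Longrightarrow> S i \<inter> A = {}"
  shows "contains_edge_disjoint P k C"
proof (rule contains_edge_disjointI)
  fix i l assume "i < k" "l < k" "i \<noteq> l"
  then show "(S(j := A)) i \<inter> (S(j := A)) l = {}"
    using assms(3,6) by (auto simp: Int_commute)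
qed (use assms in auto)

section \<open>Cuts and spanning trees\<close>

definition adj :: "'v set set \<Rightarrow> ('v \<times> 'v) set" where
  "adj F = {(x, y). {x, y} \<in> F}"

lemma adj_rtrancl_sym: "(x, y) \<in> (adj F)\<^sup>* \<Longrightarrow> (y, x) \<in> (adj F)\<^sup>*"
proof -
  have "sym (adj F)" by (auto simp: sym_def adj_def insert_commute)
  then show "(x, y) \<in> (adj F)\<^sup>* \<Longrightarrow> (y, x) \<in> (adj F)\<^sup>*"
    using sym_rtrancl by (auto dest: symD)
qed

lemma adj_rtrancl_mono: "(x, y) \<in> (adj F)\<^sup>* \<Longrightarrow> F \<subseteq> G \<Longrightarrow> (x, y) \<in> (adj G)\<^sup>*"
  by (rule subsetD[OF rtrancl_mono]) (auto simp: adj_def)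

lemma connected_graph_adj: "connected_graph V F \<longleftrightarrow> (\<forall>u\<in>V. \<forall>v\<in>V. (u, v) \<in> (adj F)\<^sup>*)"
  by (simp add: connected_graph_def adj_def)

lemma connected_graph_hub:
  assumes "\<And>z. z \<in> V \<Longrightarrow> (u, z) \<in> (adj F)\<^sup>*"
  shows "connected_graph V F"
  unfolding connected_graph_adj using assms by (meson adj_rtrancl_sym rtrancl_trans)

text \<open>Without \<open>cs ! 0\<close> the rest of the cycle still leads from
  \<open>vs ! 1\<close> to \<open>vs ! 0\<close>, and this detour replaces the deleted copy in every
  path.\<close>

lemma connected_delete_cycle_edge:
  assumes conn: "connected_graph V (fst ` S)" and cyc: "multigraph_cycle vs cs" "set cs \<subseteq> S"
  shows "connected_graph V (fst ` (S - {cs ! 0}))"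
proof -
  let ?c = "cs ! 0" and ?A = "adj (fst ` (S - {cs ! 0}))" and ?L = "length vs"
  have L: "2 \<le> ?L" "length cs = ?L" and dist: "distinct cs"
    and ends: "\<And>i. i < ?L \<Longrightarrow> fst (cs ! i) = {vs ! i, vs ! (Suc i mod ?L)}"
    using cyc(1) by (auto simp: multigraph_cycle_def)
  have pos: "0 < ?L" using L by linarith
  have edge: "(vs ! i, vs ! (Suc i mod ?L)) \<in> ?A" if "0 < i" "i < ?L" for i
  proof -
    have "cs ! i \<noteq> ?c" using nth_eq_iff_index_eq[OF dist, of i 0] that pos L by simp
    moreover have "cs ! i \<in> S" using that L cyc(2) by (auto intro: nth_mem)
    ultimately have "fst (cs ! i) \<in> fst ` (S - {?c})" by blast
    then show ?thesis unfolding adj_def using ends[OF that(2)] by simp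
  qed
  have path: "(vs ! 1, vs ! i) \<in> ?A\<^sup>*" if "1 \<le> i" "i < ?L" for i
    using that
  proof (induction i rule: dec_induct)
    case (step i)
    then have "(vs ! i, vs ! Suc i) \<in> ?A" using edge[of i] by simp
    with step show ?case by (auto intro: rtrancl_into_rtrancl)
  qed simp
  \<comment> \<open>The last edge returns to \<open>vs ! 0\<close> because its index wraps around
    modulo the length. For a cycle of length 2 the path before it is empty.\<close>
  have "(vs ! 1, vs ! (?L - 1)) \<in> ?A\<^sup>*" using path[of "?L - 1"] L by simp
  moreover have "(vs ! (?L - 1), vs ! 0) \<in> ?A"
    using edge[of "?L - 1"] L by (cases "length vs") auto
  ultimately have return: "(vs ! 1, vs ! 0) \<in> ?A\<^sup>*" by (rule rtrancl_into_rtrancl)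
  note both = adj_rtrancl_sym[OF return] return
  have "adj (fst ` S) \<subseteq> ?A\<^sup>*"
  proof
    fix xy assume "xy \<in> adj (fst ` S)"
    then obtain x y where "xy = (x, y)" "{x, y} \<in> fst ` S" by (auto simp: adj_def)
    then obtain d where d: "xy = (x, y)" "d \<in> S" "fst d = {x, y}" by (metis imageE)
    show "xy \<in> ?A\<^sup>*"
    proof (cases "d = ?c")
      case True
      then have "{x, y} = {vs ! 0, vs ! 1}" using ends[of 0] pos L d by simp
      then show ?thesis using both d(1) by (auto simp: doubleton_eq_iff)
    next
      case False
      with d have "{x, y} \<in> fst ` (S - {?c})" by (metis Diff_iff image_eqI singletonD)
      then show ?thesis using d(1) by (auto simp: adj_def)
    qed
  qed
  then have "(adj (fst ` S))\<^sup>* \<subseteq> ?A\<^sup>*" by (metis rtrancl_mono rtrancl_idemp)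
  then show ?thesis using conn unfolding connected_graph_adj by blast
qed

text \<open>Copies on cycles are deleted one at a time without losing connectedness; finiteness
  makes this stop.\<close>

lemma ex_spanning_tree:
  assumes "finite S" "connected_graph V (fst ` S)"
  shows "\<exists>S'\<subseteq>S. spanning_tree V S'"
  using assms
proof (induction S rule: finite_psubset_induct)
  case (psubset S)
  show ?case
  proof (cases "spanning_tree V S")
    case False
    then obtain vs cs where cyc: "multigraph_cycle vs cs" "set cs \<subseteq> S"
      using psubset.prems by (auto simp: spanning_tree_def)
    then have "cs ! 0 \<in> S" by (auto simp: multigraph_cycle_def intro!: subsetD[OF cyc(2)] nth_mem)
    then have "S - {cs ! 0} \<subset> S" by blast
    with psubset.IH[of "S - {cs ! 0}"] connected_delete_cycle_edge[OF psubset.prems cyc]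
    show ?thesis by blast
  qed blast
qed

text \<open>Connected members can be pruned to trees inside themselves, so they remain disjoint.
  This frees the exchange argument from checking acyclicity.\<close>

lemma contains_spanning_trees_iff:
  assumes "finite C"
  shows "contains_edge_disjoint (spanning_tree V) k C \<longleftrightarrow>
    contains_edge_disjoint (\<lambda>S. connected_graph V (fst ` S)) k C"
proof
  assume "contains_edge_disjoint (spanning_tree V) k C"
  then show "contains_edge_disjoint (\<lambda>S. connected_graph V (fst ` S)) k C"
    unfolding contains_edge_disjoint_def spanning_tree_def by blast
next
  assume "contains_edge_disjoint (\<lambda>S. connected_graph V (fst ` S)) k C"
  then obtain S where S: "\<And>i. i < k \<Longrightarrow> S i \<subseteq> C" "\<And>i. i < k \<Longrightarrow> connected_graph V (fst ` S i)"
    and disj: "\<And>i j. i < k \<Longrightarrow> j < k \<Longrightarrow> i \<noteq> j \<Longrightarrow> S i \<inter> S j = {}"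
    by (rule contains_edge_disjointE) blast
  have "\<exists>S'\<subseteq>S i. spanning_tree V S'" if "i < k" for i
    using S[OF that] assms by (intro ex_spanning_tree) (auto dest: finite_subset)
  then obtain S' where S': "\<And>i. i < k \<Longrightarrow> S' i \<subseteq> S i \<and> spanning_tree V (S' i)" by metis
  show "contains_edge_disjoint (spanning_tree V) k C"
  proof (rule contains_edge_disjointI)
    fix i j assume "i < k" "j < k" "i \<noteq> j"
    then show "S' i \<inter> S' j = {}" using S' disj by blast
  qed (use S S' in blast)+
qed

section \<open>Edge cuts and the exchange of a critical edge\<close>

definition cut :: "'v set set \<Rightarrow> 'v set \<Rightarrow> 'v set set" where
  "cut F X = {e\<in>F. e \<inter> X \<noteq> {} \<and> \<not> e \<subseteq> X}"

lemma cut_nonempty: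
  assumes "connected_graph V F" "u \<in> V" "u \<in> X" "v \<in> V" "v \<notin> X"
  shows "cut F X \<noteq> {}"
proof
  assume "cut F X = {}"
  moreover have "(u, v) \<in> (adj F)\<^sup>*" using assms by (auto simp: connected_graph_adj)
  then have "v \<in> X" if "cut F X = {}"
  proof induction
    case (step y z)
    then have "{y, z} \<in> F" "y \<in> X" using that by (auto simp: adj_def)
    then show ?case using that by (auto simp: cut_def)
  qed fact
  ultimately show False using assms by blast
qed

text \<open>Each of the \<open>k\<close> subgraphs crosses the cut, and disjointness makes the
  crossing copies distinct.\<close>

lemma cut_card_ge:
  assumes "finite E" and "contains_edge_disjoint (\<lambda>S. connected_graph V (fst ` S)) k (edge_copies E n)"
    and X: "u \<in> V" "u \<in> X" "v \<in> V" "v \<notin> X"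
  shows "k \<le> sum n (cut E X)"
proof -
  obtain S where S: "\<And>i. i < k \<Longrightarrow> S i \<subseteq> edge_copies E n" "\<And>i. i < k \<Longrightarrow> connected_graph V (fst ` S i)"
    and disj: "\<And>i j. i < k \<Longrightarrow> j < k \<Longrightarrow> i \<noteq> j \<Longrightarrow> S i \<inter> S j = {}"
    using assms(2) by (rule contains_edge_disjointE) blast
  have "\<exists>c. c \<in> S i \<and> fst c \<in> cut E X" if "i < k" for i
  proof -
    have "cut (fst ` S i) X \<noteq> {}" using S(2)[OF that] X by (rule cut_nonempty)
    then obtain c where "c \<in> S i" "fst c \<inter> X \<noteq> {} \<and> \<not> fst c \<subseteq> X" by (auto simp: cut_def)
    moreover have "fst c \<in> E" using S(1)[OF that] \<open>c \<in> S i\<close> by (auto simp: edge_copies_def)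
    ultimately show ?thesis by (intro exI[of _ c]) (simp add: cut_def)
  qed
  then obtain c where c: "\<And>i. i < k \<Longrightarrow> c i \<in> S i \<and> fst (c i) \<in> cut E X" by metis
  have fin: "finite (cut E X)" using \<open>finite E\<close> by (simp add: cut_def)
  have "inj_on c {..<k}"
  proof (rule inj_onI, rule ccontr)
    fix i j assume "i \<in> {..<k}" "j \<in> {..<k}" "c i = c j" "i \<noteq> j"
    then show False using disj[of i j] c[of i] c[of j] by auto
  qed
  moreover have "c ` {..<k} \<subseteq> edge_copies (cut E X) n"
  proof
    fix d assume "d \<in> c ` {..<k}"
    then obtain i where "i < k" "d = c i" by auto
    then have "d \<in> edge_copies E n" "fst d \<in> cut E X" using c[of i] S(1)[of i] by auto
    then show "d \<in> edge_copies (cut E X) n" by (auto simp: edge_copies_def)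
  qed
  ultimately have "card {..<k} \<le> card (edge_copies (cut E X) n)"
    using fin by (intro card_inj_on_le finite_edge_copies)
  also have "\<dots> = sum n (cut E X)" using fin by (simp add: edge_copies_def)
  finally show ?thesis by simp
qed

text \<open>After its last use of the edge \<open>{u, v}\<close>, a path starts afresh at
  \<open>u\<close> or \<open>v\<close> and stays in \<open>F\<close>.\<close>

lemma adj_insert_reach:
  assumes "(u, z) \<in> (adj (insert {u, v} F))\<^sup>*"
  shows "(u, z) \<in> (adj F)\<^sup>* \<or> (v, z) \<in> (adj F)\<^sup>*"
  using assms
proof induction
  case (step y z)
  then show ?case
    by (auto simp: adj_def doubleton_eq_iff intro: rtrancl_into_rtrancl)
qed simp

text \<open>Some member \<open>S j\<close> uses the new copy of \<open>e\<close>. Without this copy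
  \<open>S j\<close> falls into two parts, and \<open>X\<close> is the component of
  \<open>u\<close>; every edge leaving \<open>X\<close> rejoins the parts and can thus take the
  place of \<open>e\<close>.\<close>

lemma critical_edge_cut:
  assumes "simple_graph V E" and "e \<in> E"
    and packed: "contains_edge_disjoint (\<lambda>S. connected_graph V (fst ` S)) k (edge_copies E (bump e n))"
    and not: "\<not> contains_edge_disjoint (\<lambda>S. connected_graph V (fst ` S)) k (edge_copies E n)"
  shows "\<exists>X u v. u \<in> V \<and> u \<in> X \<and> v \<in> V \<and> v \<notin> X \<and> (\<forall>e'\<in>cut E X.
    contains_edge_disjoint (\<lambda>S. connected_graph V (fst ` S)) k (edge_copies E (bump e' n)))"
proof -
  let ?c = "(e, n e)" and ?C = "edge_copies E n"
  obtain u v where e: "e = {u, v}" and uv: "u \<in> V" "v \<in> V"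
    using assms(1,2) by (force simp: simple_graph_def card_2_iff)
  obtain S where sub: "\<And>i. i < k \<Longrightarrow> S i \<subseteq> insert ?c ?C"
      and conn: "\<And>i. i < k \<Longrightarrow> connected_graph V (fst ` S i)"
      and disj: "\<And>i j. i < k \<Longrightarrow> j < k \<Longrightarrow> i \<noteq> j \<Longrightarrow> S i \<inter> S j = {}"
    using packed unfolding edge_copies_bump[OF \<open>e \<in> E\<close>] by (rule contains_edge_disjointE) blast
  obtain j where j: "j < k" "?c \<in> S j"
  proof (rule ccontr)
    assume "\<not> thesis"
    then have "\<And>i. i < k \<Longrightarrow> S i \<subseteq> ?C" using that sub by blast
    then have "contains_edge_disjoint (\<lambda>S. connected_graph V (fst ` S)) k ?C"
      using conn disj by (rule contains_edge_disjointI)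
    with not show False by blast
  qed
  have other: "S i \<subseteq> ?C" if "i < k" "i \<noteq> j" for i
    using sub[OF that(1)] disj[of i j] that j by blast
  define F where "F = fst ` (S j - {?c})"
  define X where "X = {x. (u, x) \<in> (adj F)\<^sup>*}"
  have "fst ` S j = insert {u, v} F" using j e by (force simp: F_def)
  then have reach: "(u, z) \<in> (adj F)\<^sup>* \<or> (v, z) \<in> (adj F)\<^sup>*" if "z \<in> V" for z
    using conn[OF j(1)] uv that by (intro adj_insert_reach) (auto simp: connected_graph_adj)
  \<comment> \<open>Otherwise \<open>S j\<close> would be connected without the new copy,
    contradicting \<open>not\<close>.\<close>
  have "v \<notin> X"
  proof
    assume "v \<in> X"
    then have "(u, z) \<in> (adj F)\<^sup>*" if "z \<in> V" for z
      using reach[OF that] by (auto simp: X_def)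
    then have conn': "connected_graph V (fst ` (S j - {?c}))"
      unfolding F_def[symmetric] by (rule connected_graph_hub)
    have "contains_edge_disjoint (\<lambda>S. connected_graph V (fst ` S)) k ?C"
    proof (rule contains_edge_disjoint_update[OF other conn disj _ conn'])
      show "S j - {?c} \<subseteq> ?C" using sub[OF j(1)] by blast
      show "S i \<inter> (S j - {?c}) = {}" if "i < k" "i \<noteq> j" for i
        using disj[OF that(1) j(1) that(2)] by blast
    qed
    with not show False by blast
  qed
  moreover have "contains_edge_disjoint (\<lambda>S. connected_graph V (fst ` S)) k (edge_copies E (bump e' n))"
    if e': "e' \<in> cut E X" for e'
  proof -
    have "e' \<in> E" using e' by (simp add: cut_def)
    have "card e' = 2" using \<open>e' \<in> E\<close> assms(1) by (simp add: simple_graph_def)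
    then obtain x y where xy: "e' = {x, y}" by (auto simp: card_2_iff)
    with e' have "x \<in> X \<and> y \<notin> X \<or> y \<in> X \<and> x \<notin> X"
      by (auto simp: cut_def)
    then obtain a b where ab: "e' = {a, b}" "a \<in> X" "b \<notin> X"
      using xy insert_commute[of x y "{}"] by blast
    have "b \<in> V" using \<open>e' \<in> E\<close> assms(1) ab by (auto simp: simple_graph_def)
    let ?d = "(e', n e')"
    let ?G = "insert e' F"
    have d_notin: "?d \<notin> ?C" by (rule not_in_edge_copies)
    \<comment> \<open>The connection runs from \<open>u\<close> to \<open>a\<close> inside
      \<open>X\<close>, over \<open>e'\<close> to \<open>b\<close>, and on to \<open>v\<close>:
      being outside \<open>X\<close>, the vertex \<open>b\<close> is reached from
      \<open>v\<close>.\<close>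
    have "(u, a) \<in> (adj ?G)\<^sup>*" using ab by (auto simp: X_def intro: adj_rtrancl_mono)
    moreover have "(a, b) \<in> adj ?G" using ab by (simp add: adj_def)
    moreover have "(v, b) \<in> (adj F)\<^sup>*" using reach[OF \<open>b \<in> V\<close>] ab by (simp add: X_def)
    then have "(b, v) \<in> (adj ?G)\<^sup>*"
      by (rule adj_rtrancl_mono[OF adj_rtrancl_sym]) blast
    ultimately have uv': "(u, v) \<in> (adj ?G)\<^sup>*"
      by (meson rtrancl_into_rtrancl rtrancl_trans)
    have "(u, z) \<in> (adj ?G)\<^sup>*" if "z \<in> V" for z
      using reach[OF that] uv' by (meson adj_rtrancl_mono rtrancl_trans subset_insertI)
    then have "connected_graph V ?G" by (rule connected_graph_hub)
    then have conn': "connected_graph V (fst ` insert ?d (S j - {?c}))" by (simp add: F_def)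
    show ?thesis
      unfolding edge_copies_bump[OF \<open>e' \<in> E\<close>]
    proof (rule contains_edge_disjoint_update[OF _ conn disj _ conn'])
      show "insert ?d (S j - {?c}) \<subseteq> insert ?d ?C" using sub[OF j(1)] by blast
      show "S i \<inter> insert ?d (S j - {?c}) = {}" if "i < k" "i \<noteq> j" for i
        using other[OF that] disj[OF that(1) j(1) that(2)] d_notin by blast
      show "S i \<subseteq> insert ?d ?C" if "i < k" "i \<noteq> j" for i
        using other[OF that] by blast
    qed
  qed
  ultimately show ?thesis using uv by (intro exI[of _ X] exI[of _ u] exI[of _ v]) (auto simp: X_def)
qed

section \<open>Thinning and triangles\<close>

text \<open>The expectation of \<open>g\<close> at a random subset of \<open>C\<close> that retains
  each element independently with probability \<open>\<theta>\<close>, encoded as a finite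
  sum.\<close>

definition keep :: "real \<Rightarrow> 'c set \<Rightarrow> ('c set \<Rightarrow> real) \<Rightarrow> real" where
  "keep \<theta> C g = (\<Sum>R\<in>Pow C. \<theta> ^ card R * (1 - \<theta>) ^ (card C - card R) * g R)"

lemma keep_empty [simp]: "keep \<theta> {} g = g {}"
  by (simp add: keep_def)

lemma keep_insert:
  assumes "finite C" "c \<notin> C"
  shows "keep \<theta> (insert c C) g = \<theta> * keep \<theta> C (\<lambda>R. g (insert c R)) + (1 - \<theta>) * keep \<theta> C g"
proof -
  let ?f = "\<lambda>R. \<theta> ^ card R * (1 - \<theta>) ^ (card (insert c C) - card R) * g R"
  have fin: "finite R" "c \<notin> R" "card R \<le> card C" if "R \<in> Pow C" for R
    using that assms by (auto dest: finite_subset intro: card_mono)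
  have "keep \<theta> (insert c C) g = sum ?f (Pow C) + sum ?f (insert c ` Pow C)"
    unfolding keep_def Pow_insert using assms by (intro sum.union_disjoint) auto
  also have "sum ?f (insert c ` Pow C) = (\<Sum>R\<in>Pow C. ?f (insert c R))"
    using assms by (intro sum.reindex_cong[of "insert c"]) (auto simp: inj_on_def)
  also have "\<dots> = \<theta> * keep \<theta> C (\<lambda>R. g (insert c R))"
    unfolding keep_def sum_distrib_left using assms fin by (intro sum.cong) auto
  also have "sum ?f (Pow C) = (1 - \<theta>) * keep \<theta> C g"
    unfolding keep_def sum_distrib_left using assms fin by (intro sum.cong) (auto simp: Suc_diff_le)
  finally show ?thesis by simp
qed

lemma keep_const: "finite C \<Longrightarrow> keep \<theta> C (\<lambda>_. a) = a"
  by (induction C rule: finite_induct) (auto simp: keep_insert algebra_simps)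

lemma keep_mono:
  assumes "0 \<le> \<theta>" "\<theta> \<le> 1" and "\<And>R. R \<subseteq> C \<Longrightarrow> f R \<le> g R"
  shows "keep \<theta> C f \<le> keep \<theta> C g"
  unfolding keep_def using assms by (intro sum_mono mult_left_mono) auto

lemma keep_sum: "keep \<theta> C (\<lambda>R. \<Sum>i\<in>I. a i * f i R) = (\<Sum>i\<in>I. a i * keep \<theta> C (f i))"
  unfolding keep_def sum_distrib_left by (subst sum.swap) (simp add: mult_ac)

lemma keep_diff: "keep \<theta> C (\<lambda>R. f R - g R) = keep \<theta> C f - keep \<theta> C g"
  unfolding keep_def by (simp add: right_diff_distrib sum_subtractf)

lemma keep_cmult: "keep \<theta> C (\<lambda>R. a * g R) = a * keep \<theta> C g"
  unfolding keep_def by (simp add: sum_distrib_left mult_ac)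

text \<open>Thinning acts independently on disjoint sets, whence the iterated expectation.\<close>

lemma keep_Un:
  assumes "finite A" "finite B" "A \<inter> B = {}"
  shows "keep \<theta> (A \<union> B) g = keep \<theta> A (\<lambda>R. keep \<theta> B (\<lambda>R'. g (R \<union> R')))"
  using assms
proof (induction A arbitrary: g rule: finite_induct)
  case (insert c A)
  then have "c \<notin> A \<union> B" by auto
  with insert show ?case by (simp add: keep_insert)
qed simp

lemma keep_not_all:
  assumes "finite J"
  shows "keep \<theta> J (\<lambda>R. if J \<subseteq> R then 0 else 1) = 1 - \<theta> ^ card J"
proof -
  have "keep \<theta> J (\<lambda>R. if J \<subseteq> R then 1 else 0) = \<theta> ^ card J * (1 - \<theta>) ^ (card J - card J) * 1"
    unfolding keep_def using assms
    by (subst sum.mono_neutral_right[of _ "{J}"]) auto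
  moreover have "keep \<theta> J (\<lambda>R. if J \<subseteq> R then 0 else 1) =
      keep \<theta> J (\<lambda>R. 1 - (if J \<subseteq> R then 1 else 0))"
    by (intro arg_cong[where f = "keep \<theta> J"]) auto
  ultimately show ?thesis
    by (simp add: keep_diff keep_const[OF assms])
qed

text \<open>The sets \<open>J i\<close> are disjoint, so their survivals are independent events of
  probability \<open>\<theta> ^ d\<close> each. The induction splits off \<open>J k\<close>.\<close>

lemma keep_no_disjoint_le:
  fixes J :: "nat \<Rightarrow> 'c set"
  assumes \<theta>: "0 \<le> \<theta>" "\<theta> \<le> 1" and "finite C"
    and "\<And>i. i < k \<Longrightarrow> J i \<subseteq> C" and "\<And>i. i < k \<Longrightarrow> card (J i) = d"
    and "\<And>i j. i < k \<Longrightarrow> j < k \<Longrightarrow> i \<noteq> j \<Longrightarrow> J i \<inter> J j = {}"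
  shows "keep \<theta> C (\<lambda>R. if \<exists>i<k. J i \<subseteq> R then 0 else 1) \<le> (1 - \<theta> ^ d) ^ k"
  using assms(3-)
proof (induction k arbitrary: C)
  case 0
  then show ?case by (simp add: keep_const)
next
  case (Suc k)
  let ?A = "C - J k" and ?g = "\<lambda>k R. if \<exists>i<k. J i \<subseteq> R then 0 else 1 :: real"
  have sub: "J i \<subseteq> ?A" if "i < k" for i
    using Suc.prems(2)[of i] Suc.prems(4)[of i k] that by auto
  have C: "C = ?A \<union> J k" using Suc.prems(2)[of k] by auto
  have fin: "finite ?A" "finite (J k)"
    using Suc.prems(1) Suc.prems(2)[of k] by (auto dest: finite_subset)
  have split: "?g (Suc k) (R \<union> R') = ?g k R * (if J k \<subseteq> R' then 0 else 1)"
    if R: "R \<subseteq> ?A" "R' \<subseteq> J k" for R R'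
  proof -
    have "J k \<subseteq> R \<union> R' \<longleftrightarrow> J k \<subseteq> R'" using R by blast
    moreover have "J i \<subseteq> R \<union> R' \<longleftrightarrow> J i \<subseteq> R" if "i < k" for i
      using R sub[OF that] by blast
    ultimately show ?thesis by (auto simp: less_Suc_eq)
  qed
  have "keep \<theta> C (?g (Suc k)) = keep \<theta> ?A (\<lambda>R. keep \<theta> (J k) (\<lambda>R'. ?g (Suc k) (R \<union> R')))"
    by (subst C, rule keep_Un) (use fin in auto)
  also have "\<dots> \<le> keep \<theta> ?A (\<lambda>R. keep \<theta> (J k) (\<lambda>R'. ?g k R * (if J k \<subseteq> R' then 0 else 1)))"
    using \<theta> split by (intro keep_mono) simp_all
  also have "\<dots> = keep \<theta> ?A (\<lambda>R. (1 - \<theta> ^ d) * ?g k R)"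
  proof -
    have "keep \<theta> (J k) (\<lambda>R'. ?g k R * (if J k \<subseteq> R' then 0 else 1)) = (1 - \<theta> ^ d) * ?g k R" for R
      by (simp only: keep_cmult keep_not_all[OF fin(2)] Suc.prems(3)[OF lessI]) (rule mult.commute)
    then show ?thesis by (simp only:)
  qed
  also have "\<dots> = (1 - \<theta> ^ d) * keep \<theta> ?A (?g k)"
    by (rule keep_cmult)
  also have "\<dots> \<le> (1 - \<theta> ^ d) * (1 - \<theta> ^ d) ^ k"
    using \<theta> fin(1) sub Suc.prems by (intro mult_left_mono Suc.IH) (auto simp: power_le_one)
  finally show ?case by simp
qed

text \<open>A thinned set of copies has gaps in its indices. Recording only the number of survivors
  per edge turns it into a state of the walk again.\<close>

definition copy_count :: "'v edge_copy set \<Rightarrow> 'v set \<Rightarrow> nat" where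
  "copy_count R e = card {i. (e, i) \<in> R}"

lemma copy_count_empty: "copy_count {} = (\<lambda>_. 0)"
  by (simp add: copy_count_def fun_eq_iff)

lemma copy_count_insert:
  assumes "finite R" "(e, i) \<notin> R"
  shows "copy_count (insert (e, i) R) = bump e (copy_count R)"
proof
  fix e'
  have "finite {i. (e', i) \<in> R}"
    by (rule finite_subset[of _ "snd ` R"]) (use assms in force)+
  moreover have "{j. (e, j) \<in> insert (e, i) R} = insert i {j. (e, j) \<in> R}" by auto
  ultimately show "copy_count (insert (e, i) R) e' = bump e (copy_count R) e'"
    using assms by (cases "e' = e") (auto simp: copy_count_def bump_def)
qed

text \<open>The triangles of the second configuration are shifted past the \<^term>\<open>n\<close> copies already
  present; the single new copy of \<^term>\<open>e\<close> spoils at most one of the \<^term>\<open>k\<close> triangles.\<close>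

lemma triangles_bump_add:
  assumes "e \<in> E" and packed: "contains_edge_disjoint triangle k (edge_copies E (bump e n))"
    and one: "contains_edge_disjoint triangle 1 (edge_copies E n')"
  shows "contains_edge_disjoint triangle k (edge_copies E (\<lambda>x. n x + n' x))"
proof -
  let ?C = "edge_copies E n" and ?C' = "edge_copies E (\<lambda>x. n x + n' x)"
  have CC': "?C \<subseteq> ?C'" by (rule edge_copies_mono) simp
  obtain S where sub: "\<And>i. i < k \<Longrightarrow> S i \<subseteq> insert (e, n e) ?C"
      and tri: "\<And>i. i < k \<Longrightarrow> triangle (S i)"
      and disj: "\<And>i j. i < k \<Longrightarrow> j < k \<Longrightarrow> i \<noteq> j \<Longrightarrow> S i \<inter> S j = {}"
    using packed unfolding edge_copies_bump[OF \<open>e \<in> E\<close>] by (rule contains_edge_disjointE) blast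
  show ?thesis
  proof (cases "\<exists>j<k. (e, n e) \<in> S j")
    case False
    then have "S i \<subseteq> ?C'" if "i < k" for i using sub[OF that] that CC' by blast
    then show ?thesis using tri disj by (rule contains_edge_disjointI)
  next
    case True
    then obtain j where j: "j < k" "(e, n e) \<in> S j" by blast
    have other: "S i \<subseteq> ?C" if "i < k" "i \<noteq> j" for i
      using sub[OF that(1)] disj[OF that(1) j(1) that(2)] j by blast
    obtain x y z a b c where xyz: "x \<noteq> y" "y \<noteq> z" "x \<noteq> z"
      and abc: "{({x, y}, a), ({y, z}, b), ({x, z}, c)} \<subseteq> edge_copies E n'"
      using one by (auto simp: contains_edge_disjoint_def triangle_def)
    define A where "A = {({x, y}, n {x, y} + a), ({y, z}, n {y, z} + b), ({x, z}, n {x, z} + c)}"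
    have A: "triangle A" unfolding triangle_def A_def using xyz by blast
    have "A \<subseteq> ?C'" using abc by (auto simp: A_def edge_copies_def)
    moreover have "?C \<inter> A = {}" by (auto simp: A_def edge_copies_def)
    ultimately show ?thesis
      using other CC' by (intro contains_edge_disjoint_update[OF _ tri disj _ A]) blast+
  qed
qed

text \<open>Surviving indices need not start at 0, so the triangle is rebuilt from the copies with
  index 0, which exist for every edge with a survivor.\<close>

lemma triangle_copy_count:
  assumes "finite R" "R \<subseteq> E \<times> UNIV" "S \<subseteq> R" "triangle S"
  shows "contains_edge_disjoint triangle 1 (edge_copies E (copy_count R))"
proof -
  obtain x y z a b c where xyz: "x \<noteq> y" "y \<noteq> z" "x \<noteq> z"
    and abc: "{({x, y}, a), ({y, z}, b), ({x, z}, c)} \<subseteq> R"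
    using assms(3,4) by (auto simp: triangle_def)
  have "(e, 0) \<in> edge_copies E (copy_count R)" if "(e, i) \<in> R" for e i
  proof -
    have "finite {i. (e, i) \<in> R}"
      by (rule finite_subset[of _ "snd ` R"]) (use assms(1) in force)+
    then have "0 < copy_count R e" using that by (auto simp: copy_count_def card_gt_0_iff)
    then show ?thesis using that assms(2) by (auto simp: edge_copies_def)
  qed
  then have "{({x, y}, 0), ({y, z}, 0), ({x, z}, 0)} \<subseteq> edge_copies E (copy_count R)"
    using abc by blast
  moreover have "triangle {({x, y}, 0::nat), ({y, z}, 0), ({x, z}, 0)}"
    unfolding triangle_def using xyz by blast
  ultimately show ?thesis
    by (intro contains_edge_disjointI[where S = "\<lambda>_. {({x, y}, 0), ({y, z}, 0), ({x, z}, 0)}"]) auto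
qed

lemma card_triangle: "triangle S \<Longrightarrow> card S = 3"
  unfolding triangle_def by (auto simp: doubleton_eq_iff)

text \<open>The thinned walk, observed through \<open>\<psi>\<close>, is slower by the factor \<open>\<theta>\<close>. By
  \<open>(1 - 1 / k) ^ k \<le> 1 / exp 1\<close> it contains a triangle with probability at least \<open>1 - 1 / exp 1\<close>
  as soon as there are \<open>k\<close> disjoint triangles, and otherwise it starts afresh.\<close>

lemma mean_hit_triangles_le:
  fixes E :: "'v set set"
  assumes one: "recurrent_hitting E p (\<lambda>n. contains_edge_disjoint triangle 1 (edge_copies E n)) 1"
    and many: "recurrent_hitting E p (\<lambda>n. contains_edge_disjoint triangle k (edge_copies E n)) k"
    and "1 \<le> k"
  shows "hitting.mean_hit E p (\<lambda>n. contains_edge_disjoint triangle 1 (edge_copies E n)) (\<lambda>_. 0) \<le>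
    exp 1 / (exp 1 - 1) * real k powr (- 1 / 3) *
    hitting.mean_hit E p (\<lambda>n. contains_edge_disjoint triangle k (edge_copies E n)) (\<lambda>_. 0)"
proof -
  let ?U1 = "\<lambda>n. contains_edge_disjoint triangle 1 (edge_copies E n)"
  let ?Uk = "\<lambda>n. contains_edge_disjoint triangle k (edge_copies E n)"
  interpret A: recurrent_hitting E p ?U1 1 by (rule one)
  interpret B: recurrent_hitting E p ?Uk k by (rule many)
  define \<theta> where "\<theta> = real k powr (- 1 / 3)"
  have \<theta>: "0 < \<theta>" "\<theta> \<le> 1"
    using \<open>1 \<le> k\<close> powr_mono[of "- 1 / 3" 0 "real k"] by (auto simp: \<theta>_def)
  have "\<theta> ^ 3 = real k powr (- 1)"
    using \<open>1 \<le> k\<close> by (simp add: \<theta>_def powr_power)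
  then have cube: "\<theta> ^ 3 = 1 / real k"
    using \<open>1 \<le> k\<close> by (simp add: powr_minus_divide)
  define h where "h = A.mean_hit (\<lambda>_. 0)"
  have h: "0 \<le> h" unfolding h_def by (rule A.mean_hit_nonneg)
  \<comment> \<open>A step reaches the thinned set only with probability \<open>\<theta>\<close>;
    dividing by \<open>\<theta>\<close> makes the average decrease per step at most 1.\<close>
  define \<psi> where "\<psi> n = keep \<theta> (edge_copies E n) (\<lambda>R. A.mean_hit (copy_count R)) / \<theta>" for n
  have fin: "finite (edge_copies E n)" for n by (rule finite_edge_copies[OF A.finite_E])
  \<comment> \<open>Here \<open>b = h / (\<theta> * exp 1)\<close> bounds \<open>\<psi>\<close> on
    the target, and \<open>D = h / \<theta>\<close> covers all other states.\<close>
  have "\<psi> (\<lambda>_. 0) \<le> B.mean_hit (\<lambda>_. 0) + h / (\<theta> * exp 1)"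
  proof (rule B.subsolution_le_mean_hit)
    fix n
    let ?C = "edge_copies E n"
    let ?f = "\<lambda>R. A.mean_hit (copy_count R)"
    show "\<psi> n \<le> h / (\<theta> * exp 1) + h / \<theta>"
    proof -
      have "keep \<theta> ?C ?f \<le> keep \<theta> ?C (\<lambda>_. h)"
        using \<theta> unfolding h_def by (intro keep_mono A.mean_hit_le_start) auto
      also have "\<dots> = h" by (rule keep_const[OF fin])
      finally have "\<psi> n \<le> h / \<theta>" unfolding \<psi>_def using \<theta> by (intro divide_right_mono) auto
      moreover have "0 \<le> h / (\<theta> * exp 1)" using h \<theta> by simp
      ultimately show ?thesis by simp
    qed
    show "\<psi> n \<le> 1 + (\<Sum>e\<in>E. p e * \<psi> (bump e n))"
    proof -
      have step: "\<theta> * \<psi> (bump e n) = \<theta> * keep \<theta> ?C (\<lambda>R. A.mean_hit (bump e (copy_count R)))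
          + (1 - \<theta>) * keep \<theta> ?C ?f" if "e \<in> E" for e
      proof -
        have "keep \<theta> (insert (e, n e) ?C) ?f =
          \<theta> * keep \<theta> ?C (\<lambda>R. ?f (insert (e, n e) R)) + (1 - \<theta>) * keep \<theta> ?C ?f"
          by (rule keep_insert[OF fin not_in_edge_copies])
        also have "keep \<theta> ?C (\<lambda>R. ?f (insert (e, n e) R)) =
            keep \<theta> ?C (\<lambda>R. A.mean_hit (bump e (copy_count R)))"
          unfolding keep_def
        proof (rule sum.cong[OF refl])
          fix R assume "R \<in> Pow ?C"
          then have "finite R" "(e, n e) \<notin> R"
            using fin[of n] not_in_edge_copies[of e n E] by (auto dest: finite_subset)
          then show "\<theta> ^ card R * (1 - \<theta>) ^ (card ?C - card R) * ?f (insert (e, n e) R) =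
              \<theta> ^ card R * (1 - \<theta>) ^ (card ?C - card R) * A.mean_hit (bump e (copy_count R))"
            by (simp add: copy_count_insert)
        qed
        finally show ?thesis using \<theta> that by (simp add: \<psi>_def edge_copies_bump)
      qed
      have "(\<Sum>e\<in>E. p e * (\<theta> * \<psi> (bump e n))) =
          \<theta> * keep \<theta> ?C (\<lambda>R. \<Sum>e\<in>E. p e * A.mean_hit (bump e (copy_count R))) + (1 - \<theta>) * keep \<theta> ?C ?f"
        using A.average_const[of "(1 - \<theta>) * keep \<theta> ?C ?f"]
        by (simp add: step keep_sum distrib_left sum.distrib sum_distrib_left mult.left_commute cong: sum.cong)
      moreover have "keep \<theta> ?C (\<lambda>R. ?f R - 1) \<le>
          keep \<theta> ?C (\<lambda>R. \<Sum>e\<in>E. p e * A.mean_hit (bump e (copy_count R)))"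
      proof (rule keep_mono)
        fix R
        \<comment> \<open>As \<open>avoid\<close> at time 0 is at most 1, the recursion for
          \<open>mean_hit\<close> gives this both on and off the target.\<close>
        show "?f R - 1 \<le> (\<Sum>e\<in>E. p e * A.mean_hit (bump e (copy_count R)))"
          using A.mean_hit_rec[of "copy_count R"] A.avoid_le_1[of ?U1 0 "copy_count R"] by linarith
      qed (use \<theta> in auto)
      then have "keep \<theta> ?C ?f - 1 \<le>
          keep \<theta> ?C (\<lambda>R. \<Sum>e\<in>E. p e * A.mean_hit (bump e (copy_count R)))"
        by (simp add: keep_diff keep_const[OF fin])
      then have "\<theta> * (keep \<theta> ?C ?f - 1) \<le>
          \<theta> * keep \<theta> ?C (\<lambda>R. \<Sum>e\<in>E. p e * A.mean_hit (bump e (copy_count R)))"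
        using \<theta> by (intro mult_left_mono) auto
      ultimately have "\<theta> * \<psi> n - \<theta> \<le> (\<Sum>e\<in>E. p e * (\<theta> * \<psi> (bump e n)))"
        using \<theta> by (simp add: \<psi>_def algebra_simps)
      also have "\<dots> = \<theta> * (\<Sum>e\<in>E. p e * \<psi> (bump e n))"
        by (simp add: sum_distrib_left mult.left_commute)
      finally have "\<theta> * \<psi> n \<le> \<theta> * (1 + (\<Sum>e\<in>E. p e * \<psi> (bump e n)))"
        by (simp add: algebra_simps)
      then show ?thesis using \<theta> by (simp only: mult_le_cancel_left_pos)
    qed
    show "\<psi> n \<le> h / (\<theta> * exp 1)" if U: "?Uk n"
    proof -
      obtain S where sub: "\<And>i. i < k \<Longrightarrow> S i \<subseteq> ?C" and tri: "\<And>i. i < k \<Longrightarrow> triangle (S i)"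
          and disj: "\<And>i j. i < k \<Longrightarrow> j < k \<Longrightarrow> i \<noteq> j \<Longrightarrow> S i \<inter> S j = {}"
        using U by (rule contains_edge_disjointE) blast
      have "keep \<theta> ?C ?f \<le> keep \<theta> ?C (\<lambda>R. h * (if \<exists>i<k. S i \<subseteq> R then 0 else 1))"
      proof (rule keep_mono)
        fix R assume R: "R \<subseteq> ?C"
        show "?f R \<le> h * (if \<exists>i<k. S i \<subseteq> R then 0 else 1)"
        proof (cases "\<exists>i<k. S i \<subseteq> R")
          case True
          then obtain i where "i < k" "S i \<subseteq> R" by blast
          moreover have "R \<subseteq> E \<times> UNIV" using R by (auto simp: edge_copies_def)
          ultimately have "?U1 (copy_count R)"
            using R fin tri by (intro triangle_copy_count) (auto dest: finite_subset)
          then have "?f R = 0" by (rule A.mean_hit_on)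
          then show ?thesis using True by (simp only: if_True mult_zero_right order_refl)
        next
          case False
          then show ?thesis
            using A.mean_hit_le_start by (simp only: h_def if_False mult_1_right)
        qed
      qed (use \<theta> in auto)
      also have "\<dots> \<le> h * (1 - \<theta> ^ 3) ^ k"
        unfolding keep_cmult using h \<theta> sub tri disj fin
        by (intro mult_left_mono keep_no_disjoint_le) (auto simp: card_triangle)
      \<comment> \<open>This uses \<open>1 - x \<le> exp (- x)\<close> with
        \<open>x = 1 / k\<close>.\<close>
      also have "(1 - \<theta> ^ 3) ^ k \<le> exp (- (1 / real k)) ^ k"
        unfolding cube using \<open>1 \<le> k\<close> exp_ge_add_one_self[of "- (1 / real k)"]
        by (intro power_mono) (auto simp: divide_le_eq)
      also have "exp (- (1 / real k)) ^ k = exp (real k * - (1 / real k))"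
        by (rule exp_of_nat_mult[symmetric])
      also have "\<dots> = 1 / exp 1"
        using \<open>1 \<le> k\<close> by (simp add: exp_minus inverse_eq_divide)
      finally have "keep \<theta> ?C ?f \<le> h / exp 1" using h by (simp add: mult_left_mono)
      then have "\<psi> n \<le> h / exp 1 / \<theta>"
        unfolding \<psi>_def using \<theta> by (intro divide_right_mono) auto
      then show ?thesis by (simp add: mult.commute)
    qed
  qed (use h \<theta> in simp)
  moreover have "\<psi> (\<lambda>_. 0) = h / \<theta>"
    by (simp add: \<psi>_def h_def copy_count_empty edge_copies_def)
  \<comment> \<open>Collecting the two terms in \<open>h\<close> leaves the factor
    \<open>1 - 1 / exp 1\<close>, whose inverse is the constant of the theorem.\<close>
  ultimately have "h / \<theta> * (1 - 1 / exp 1) \<le> B.mean_hit (\<lambda>_. 0)"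
    by (simp add: right_diff_distrib)
  then have "h * ((exp 1 - 1) / exp 1) \<le> \<theta> * B.mean_hit (\<lambda>_. 0)"
    using \<theta> by (simp add: field_simps)
  then have "h \<le> exp 1 / (exp 1 - 1) * (\<theta> * B.mean_hit (\<lambda>_. 0))"
    by (simp add: field_simps)
  then show ?thesis by (simp add: h_def \<theta>_def mult_ac)
qed

section \<open>Both bounds, from the jump chain of the edge process\<close>

theorem proposition4:
  fixes V :: "'v set" and E :: "'v set set" and w :: "'v set \<Rightarrow> real"
    and M :: "'a measure" and N :: "'v set \<Rightarrow> real \<Rightarrow> 'a \<Rightarrow> nat"
  assumes "finite V" and "card V \<ge> 2"
    and "simple_graph V E" and "connected_graph V E"
    and "\<forall>e\<in>E. 0 < w e"
    and "prob_space M"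
    and "indep_poisson_processes M E w N"
  shows "(\<forall>k\<ge>1. finite_second_moment M (T_span V E N k) \<and> 0 < mean M (T_span V E N k) \<and>
            sd M (T_span V E N k) / mean M (T_span V E N k) \<le> 1 / sqrt (real k)) \<and>
         (contains_triangle E \<longrightarrow>
          (\<forall>k\<ge>1. finite_second_moment M (T_tria E N k) \<and> 0 < mean M (T_tria E N k) \<and>
            sd M (T_tria E N k) / mean M (T_tria E N k)
              \<le> (exp 1 / (exp 1 - 1)) powr (1 / 2) * real k powr (- 1 / 6)))"
proof -
  \<comment> \<open>Superposition: jumps of the whole process occur at rate \<open>W\<close> and
    pick the edge \<open>e\<close> with probability \<open>p e\<close>.\<close>
  define W where "W = sum w E"
  define p where "p e = w e / W" for e
  have E_fin: "finite E"
    using assms(1,3) by (auto simp: simple_graph_def intro: finite_subset[of _ "Pow V"])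
  obtain x y where xy: "x \<in> V" "y \<in> V" "x \<noteq> y"
    using \<open>card V \<ge> 2\<close> \<open>finite V\<close> by (metis card_le_Suc0_iff_eq not_less_eq_eq numeral_2_eq_2)
  have "cut E {x} \<noteq> {}" using xy by (intro cut_nonempty[OF assms(4), of x _ y]) auto
  then have E_ne: "E \<noteq> {}" by (auto simp: cut_def)
  have W: "0 < W" unfolding W_def using E_fin E_ne assms(5) by (intro sum_pos) auto
  have walk: "random_walk E p"
    by unfold_locales (use E_fin assms(5) W in \<open>auto simp: p_def W_def sum_divide_distrib[symmetric]\<close>)
  have "(\<lambda>e. W * p e) = w" using W by (auto simp: p_def)
  then have N: "indep_poisson_processes M E (\<lambda>e. W * p e) N" using assms(7) by simp
  have up: "hitting E p (\<lambda>n. contains_edge_disjoint P k (edge_copies E n))" for P k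
    by (intro hitting.intro walk hitting_axioms.intro)
       (rule contains_edge_disjoint_mono, assumption, rule edge_copies_mono)
  have counts: "multigraph_process E N t \<omega> = edge_copies E (\<lambda>e. if e \<in> E then N e t \<omega> else 0)" for t \<omega>
    unfolding multigraph_process_def by (rule edge_copies_cong) simp

  have span: "finite_second_moment M (T_span V E N k) \<and> 0 < mean M (T_span V E N k) \<and>
      sd M (T_span V E N k) / mean M (T_span V E N k) \<le> 1 / sqrt (real k)" if "1 \<le> k" for k
  proof -
    let ?U = "\<lambda>n. contains_edge_disjoint (spanning_tree V) k (edge_copies E n)"
    let ?U' = "\<lambda>n. contains_edge_disjoint (\<lambda>S. connected_graph V (fst ` S)) k (edge_copies E n)"
    have U: "?U = ?U'" using contains_spanning_trees_iff[OF finite_edge_copies[OF E_fin]] by blast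
    have reach: "?U n" if n: "\<And>e. e \<in> E \<Longrightarrow> k \<le> n e" for n
      unfolding fun_cong[OF U]
    \<comment> \<open>The copies with index \<open>i\<close> of all edges form the
      \<open>i\<close>-th connected subgraph.\<close>
    proof (rule contains_edge_disjointI[where S = "\<lambda>i. E \<times> {i}"])
      show "E \<times> {i} \<subseteq> edge_copies E n" if "i < k" for i
        using n that by (force simp: edge_copies_def)
    qed (use assms(4) in auto)
    interpret recurrent_hitting E p ?U k
      by (intro recurrent_hitting.intro recurrent_hitting_axioms.intro up reach)
    let ?h = "mean_hit (\<lambda>_. 0)"
    have rate: "real k / sum p (cut E X) \<le> ?h" if "u \<in> V" "u \<in> X" "v \<in> V" "v \<notin> X" for u v X
    proof (rule mean_hit_ge_rate)
      show "cut E X \<subseteq> E" by (auto simp: cut_def)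
      show "cut E X \<noteq> {}" using that by (intro cut_nonempty[OF assms(4)])
      show "k \<le> sum n (cut E X)" if "?U n" for n
        using that \<open>u \<in> V\<close> \<open>u \<in> X\<close> \<open>v \<in> V\<close> \<open>v \<notin> X\<close> unfolding fun_cong[OF U]
        by (rule cut_card_ge[OF E_fin])
    qed
    have start: "\<not> ?U (\<lambda>_. 0)"
    proof
      assume "?U (\<lambda>_. 0)"
      then have "k \<le> sum (\<lambda>_. 0) (cut E {x})"
        using xy unfolding fun_cong[OF U] by (intro cut_card_ge[OF E_fin, of V k _ x "{x}" y]) auto
      with \<open>1 \<le> k\<close> show False by simp
    qed
    \<comment> \<open>The constant will be \<open>c = ?h / real k\<close>, which has to be at least
      1. Any cut shows this, since a step crosses it with probability at most 1.\<close>
    have k_le: "1 \<le> ?h / real k"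
    proof -
      have "sum p (cut E {x}) \<le> sum p E"
        using E_fin p_nonneg by (intro sum_mono2) (auto simp: cut_def)
      moreover have "0 < sum p (cut E {x})"
        using E_fin p_pos \<open>cut E {x} \<noteq> {}\<close> by (intro sum_pos) (auto simp: cut_def)
      ultimately have "real k * 1 \<le> real k * (1 / sum p (cut E {x}))"
        by (intro mult_left_mono) (auto simp: sum_p)
      also have "\<dots> \<le> ?h" using rate[of x "{x}" y] xy by simp
      finally show ?thesis using \<open>1 \<le> k\<close> by (simp add: le_divide_eq)
    qed
    \<comment> \<open>The critical cut depends on \<open>n\<close> and \<open>e\<close>, but
      \<open>rate\<close> bounds the inverse of its probability by \<open>?h / real k\<close> for
      every cut.\<close>
    have jump: "hit ?U m n \<le> ?h / real k" if e: "e \<in> E" "?U (bump e n)" for n e m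
    proof (cases "?U n")
      case True
      then show ?thesis using k_le by (simp add: hit_on)
    next
      case False
      then obtain X u v where X: "u \<in> V" "u \<in> X" "v \<in> V" "v \<notin> X"
        and crit: "\<And>e'. e' \<in> cut E X \<Longrightarrow> ?U (bump e' n)"
        using critical_edge_cut[OF assms(3) e(1)] e(2) unfolding fun_cong[OF U] by metis
      have "hit ?U m n \<le> 1 / sum p (cut E X)"
        using crit cut_nonempty[OF assms(4) X] by (intro hit_le_inverse_rate) (auto simp: cut_def)
      also have "\<dots> \<le> ?h / real k"
        using rate[OF X] \<open>1 \<le> k\<close> by (simp add: le_divide_eq mult.commute)
      finally show ?thesis .
    qed
    have T: "T_span V E N k = hitting_time N"
      by (simp add: fun_eq_iff T_span_def hitting_time_def counts)
    have "sqrt (?h / real k / ?h) = 1 / sqrt (real k)"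
      using k_le \<open>1 \<le> k\<close> by (auto simp: real_sqrt_divide)
    then show ?thesis
      using hitting_time_concentration[OF assms(6) W N start jump k_le] unfolding T by simp
  qed

  have tria: "finite_second_moment M (T_tria E N k) \<and> 0 < mean M (T_tria E N k) \<and>
      sd M (T_tria E N k) / mean M (T_tria E N k)
        \<le> (exp 1 / (exp 1 - 1)) powr (1 / 2) * real k powr (- 1 / 6)"
    if "contains_triangle E" "1 \<le> k" for k
  proof -
    let ?U = "\<lambda>k n. contains_edge_disjoint triangle k (edge_copies E n)"
    obtain a b c where abc: "a \<noteq> b" "b \<noteq> c" "a \<noteq> c" "{a, b} \<in> E" "{b, c} \<in> E" "{a, c} \<in> E"
      using \<open>contains_triangle E\<close> by (auto simp: contains_triangle_def)
    have reach: "?U l n" if n: "\<And>e. e \<in> E \<Longrightarrow> l \<le> n e" for l n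
    proof (rule contains_edge_disjointI[where S = "\<lambda>i. {({a, b}, i), ({b, c}, i), ({a, c}, i)}"])
      show "{({a, b}, i), ({b, c}, i), ({a, c}, i)} \<subseteq> edge_copies E n" if "i < l" for i
        using n[of "{a, b}"] n[of "{b, c}"] n[of "{a, c}"] abc that by (auto simp: edge_copies_def)
      show "triangle {({a, b}, i), ({b, c}, i), ({a, c}, i)}" for i
        unfolding triangle_def using abc by blast
    qed auto
    have rec: "recurrent_hitting E p (?U l) l" for l
      by (intro recurrent_hitting.intro recurrent_hitting_axioms.intro up reach)
    have start: "\<not> ?U l (\<lambda>_. 0)" if "1 \<le> l" for l
      using that by (force simp: contains_edge_disjoint_def triangle_def edge_copies_def)
    interpret recurrent_hitting E p "?U k" k by (rule rec)
    interpret one: recurrent_hitting E p "?U 1" 1 by (rule rec)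
    let ?h1 = "one.mean_hit (\<lambda>_. 0)" and ?h = "mean_hit (\<lambda>_. 0)"
    \<comment> \<open>The walk from \<open>n\<close> is compared with a walk from 0 whose counts are
      added to \<open>n\<close>: the first triangle of the latter repairs the packing.\<close>
    have jump: "hit (?U k) m n \<le> ?h1" if e: "e \<in> E" "?U k (bump e n)" for n e m
    proof -
      have "hit (?U k) m n \<le> hit (?U 1) m (\<lambda>_. 0)"
        unfolding hit_def
      proof (rule sum_mono)
        fix i
        have "avoid (?U k) i (\<lambda>x. n x + 0) \<le> avoid (?U 1) i (\<lambda>_. 0)"
          using triangles_bump_add[OF e] by (rule avoid_compare)
        then show "avoid (?U k) i n \<le> avoid (?U 1) i (\<lambda>_. 0)" by simp
      qed
      also have "\<dots> \<le> ?h1" by (rule one.hit_le_mean_hit)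
      finally show ?thesis .
    qed
    have h: "0 < ?h" using mean_hit_ge_1[OF start[OF \<open>1 \<le> k\<close>]] by simp
    have "?h1 / ?h \<le> exp 1 / (exp 1 - 1) * real k powr (- 1 / 3)"
      using mean_hit_triangles_le[OF rec rec \<open>1 \<le> k\<close>] h by (simp only: pos_divide_le_eq)
    then have "sqrt (?h1 / ?h) \<le> sqrt (exp 1 / (exp 1 - 1) * real k powr (- 1 / 3))"
      by (rule real_sqrt_le_mono)
    also have "\<dots> = (exp 1 / (exp 1 - 1)) powr (1 / 2) * real k powr (- 1 / 6)"
    proof -
      have "sqrt (exp 1 / (exp 1 - 1) * real k powr (- 1 / 3)) =
          (exp 1 / (exp 1 - 1) * real k powr (- 1 / 3)) powr (1 / 2)"
        by (rule powr_half_sqrt[symmetric]) simp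
      also have "\<dots> = (exp 1 / (exp 1 - 1)) powr (1 / 2) * (real k powr (- 1 / 3)) powr (1 / 2)"
        by (rule powr_mult)
      finally show ?thesis by (simp add: powr_powr)
    qed
    finally have bound: "sqrt (?h1 / ?h) \<le> \<dots>" .
    have T: "T_tria E N k = hitting_time N"
      by (simp add: fun_eq_iff T_tria_def hitting_time_def counts)
    note conc = hitting_time_concentration[OF assms(6) W N start[OF \<open>1 \<le> k\<close>]
        jump one.mean_hit_ge_1[OF start[OF order_refl]]]
    show ?thesis
      unfolding T
    proof (intro conjI)
      show "finite_second_moment M (hitting_time N)" by (rule conc(1))
      show "0 < mean M (hitting_time N)" by (rule conc(2))
      have "sd M (hitting_time N) / mean M (hitting_time N) \<le> sqrt (?h1 / ?h)" by (rule conc(3))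
      then show "sd M (hitting_time N) / mean M (hitting_time N)
          \<le> (exp 1 / (exp 1 - 1)) powr (1 / 2) * real k powr (- 1 / 6)"
        using bound by (rule order_trans)
    qed
  qed

  show ?thesis using span tria by blast
qed

end
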